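(* Let $f_{xxx}$ be a ternary cubic form over $\mathbb{C}$. The following are equivalent: (1) $S=T=0$ and $\theta^{\Delta}_{uuxx}\neq 0$. (2) $F^{\Delta}_{6u}=0$ and $\theta^{\Delta}_{uuxx}\neq 0$. (3) $\Delta_{xxx}=a_x^2b_x$ for some linearly independent linear forms $a_x,b_x$. (4) $f_{xxx}=a_x^2c_x+b_x^3$ for some linearly independent linear forms $a_x,b_x,c_x$. (5) $S=0$ and $\operatorname{rank}[f_{xxx}]=4$.
   Context: All forms are homogeneous polynomials with complex coefficients in $x_1,x_2,x_3$ (the zero polynomial is allowed); subscripts indicate degree, so $a_x=a_1x_1+a_2x_2+a_3x_3$ is a linear form and $f_{xxx}$ a cubic form. Let $u_1,u_2,u_3$ be further independent variables and $u_x=u_1x_1+u_2x_2+u_3x_3$. Rank: for a form $f$ of degree $d$, $\operatorname{rank}[f]$ (Waring rank) is the smallest integer $r\ge 0$ such that $f$ is a sum of $r$ $d$-th powers of linear forms in $\mathbb{C}[x_1,x_2,x_3]$. Transvectants: for forms $f,g,h$ in $x_1,x_2,x_3$ (whose coefficients may be polynomials in $u_1,u_2,u_3$, treated as constants), $\mathcal{J}_n[f,g,h]$ is obtained by applying $\Omega^n$ to $f(x)g(y)h(z)$, where $x,y,z$ are three independent triples of variables and $\Omega$ is the differential operator given by the $3\times 3$ determinant with rows $(\partial/\partial x_i)_i$, $(\partial/\partial y_i)_i$, $(\partial/\partial z_i)_i$, and then setting $y=z=x$. Concomitants of $f_{xxx}$: $\theta_{uuxx}=\frac14\mathcal{J}_2[f_{xxx},f_{xxx},u_x^2]$;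 the Hessian $\Delta_{xxx}=\frac1{12}\mathcal{J}_2[f_{xxx},f_{xxx},f_{xxx}]$ (a cubic form in $x_1,x_2,x_3$); $F_{6u}=\frac1{3072}\mathcal{J}_2[\theta_{uuxx},\theta_{uuxx},u_x^2]$; $S_{uuu}=\frac1{576}\mathcal{J}_4[f_{xxx}u_x,f_{xxx}u_x,f_{xxx}u_x]$ and $T_{uuu}=\frac1{576}\mathcal{J}_4[f_{xxx}u_x,f_{xxx}u_x,\Delta_{xxx}u_x]$ (cubic forms in $u_1,u_2,u_3$). The Aronhold invariants $S,T\in\mathbb{C}$ are obtained from $S_{uuu}$ and $T_{uuu}$, respectively, by the substitution $u^3\mapsto f$ replacing the coefficients of $u_x^3$ by the corresponding coefficients of $f_{xxx}$: i.e. the linear substitution on cubic monomials in $u$ sending $\frac{3!}{i!\,j!\,k!}u_1^iu_2^ju_3^k$ ($i+j+k=3$) to the coefficient of $x_1^ix_2^jx_3^k$ in $f_{xxx}$. Concomitants of the Hessian: $\theta^{\Delta}_{uuxx}$ and $F^{\Delta}_{6u}$ denote the concomitants $\theta_{uuxx}$ and $F_{6u}$ computed with the cubic form $\Delta_{xxx}$ in place of $f_{xxx}$. Equations such as $\theta^{\Delta}_{uuxx}=0$ mean identical vanishing as polynomials. *)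

theory Defs
  imports Complex_Main "HOL-Library.Poly_Mapping"
begin

text \<open>
  The coordinates are the three triples \<open>x\<close>, \<open>y\<close>, \<open>z\<close> occurring in the definition of the
  transvectants and the dual triple \<open>u\<close>; the indices in use are \<open>1, 2, 3\<close>. Polynomials are
  finitely supported maps from monomials (exponent vectors) to \<open>\<complex>\<close>, with the convolution product
  of \<^theory>\<open>HOL-Library.Poly_Mapping\<close>.
\<close>

datatype coord = X nat | Y nat | Z nat | U nat

type_synonym monom = "coord \<Rightarrow>\<^sub>0 nat"
type_synonym mpoly = "monom \<Rightarrow>\<^sub>0 complex"

definition Const :: "complex \<Rightarrow> mpoly" where
  "Const c = Poly_Mapping.single 0 c"

definition Var :: "coord \<Rightarrow> mpoly" where
  "Var v = Poly_Mapping.single (Poly_Mapping.single v 1) 1"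

definition coeff :: "mpoly \<Rightarrow> monom \<Rightarrow> complex" where
  "coeff p m = Poly_Mapping.lookup p m"

definition expo :: "monom \<Rightarrow> coord \<Rightarrow> nat" where
  "expo m v = Poly_Mapping.lookup m v"

text \<open>Forms are in \<open>x\<^sub>1, x\<^sub>2, x\<^sub>3\<close> only, and \<open>0\<close> is a form of every degree.\<close>

definition form :: "nat \<Rightarrow> mpoly \<Rightarrow> bool" where
  "form d p \<longleftrightarrow> (\<forall>m\<in>Poly_Mapping.keys p.
     Poly_Mapping.keys m \<subseteq> {X 1, X 2, X 3} \<and> (\<Sum>v\<in>Poly_Mapping.keys m. expo m v) = d)"

definition lin_indep :: "mpoly list \<Rightarrow> bool" where
  "lin_indep ps \<longleftrightarrow> (\<forall>c :: nat \<Rightarrow> complex.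
     (\<Sum>i<length ps. Const (c i) * ps ! i) = 0 \<longrightarrow> (\<forall>i<length ps. c i = 0))"

text \<open>The degree is a parameter of the rank, as the zero form has every degree.\<close>

definition waring_rank :: "nat \<Rightarrow> mpoly \<Rightarrow> nat" where
  "waring_rank d f = (LEAST r. \<exists>l :: nat \<Rightarrow> mpoly. (\<forall>i<r. form 1 (l i)) \<and> f = (\<Sum>i<r. l i ^ d))"

definition subst :: "(coord \<Rightarrow> mpoly) \<Rightarrow> mpoly \<Rightarrow> mpoly" where
  "subst \<sigma> p = (\<Sum>m\<in>Poly_Mapping.keys p.
     Const (coeff p m) * (\<Prod>v\<in>Poly_Mapping.keys m. \<sigma> v ^ expo m v))"

text \<open>
  In the summand, the subtraction of exponents truncates only if \<open>v\<close> does not occur in \<open>m\<close>,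
  and then the coefficient is \<open>0\<close>.
\<close>

definition pd :: "coord \<Rightarrow> mpoly \<Rightarrow> mpoly" where
  "pd v p = (\<Sum>m\<in>Poly_Mapping.keys p.
     Poly_Mapping.single (m - Poly_Mapping.single v 1) (of_nat (expo m v) * coeff p m))"

definition Omega :: "mpoly \<Rightarrow> mpoly" where
  "Omega p =
     pd (X 1) (pd (Y 2) (pd (Z 3) p)) - pd (X 1) (pd (Y 3) (pd (Z 2) p))
   - pd (X 2) (pd (Y 1) (pd (Z 3) p)) + pd (X 2) (pd (Y 3) (pd (Z 1) p))
   + pd (X 3) (pd (Y 1) (pd (Z 2) p)) - pd (X 3) (pd (Y 2) (pd (Z 1) p))"

definition x_to_y :: "mpoly \<Rightarrow> mpoly" where
  "x_to_y = subst (\<lambda>v. case v of X i \<Rightarrow> Var (Y i) | _ \<Rightarrow> Var v)"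

definition x_to_z :: "mpoly \<Rightarrow> mpoly" where
  "x_to_z = subst (\<lambda>v. case v of X i \<Rightarrow> Var (Z i) | _ \<Rightarrow> Var v)"

definition yz_to_x :: "mpoly \<Rightarrow> mpoly" where
  "yz_to_x = subst (\<lambda>v. case v of Y i \<Rightarrow> Var (X i) | Z i \<Rightarrow> Var (X i) | _ \<Rightarrow> Var v)"

text \<open>Arguments are meant to be polynomials in \<open>x\<close> and \<open>u\<close>.\<close>

definition transvectant :: "nat \<Rightarrow> mpoly \<Rightarrow> mpoly \<Rightarrow> mpoly \<Rightarrow> mpoly" where
  "transvectant n f g h = yz_to_x ((Omega ^^ n) (f * x_to_y g * x_to_z h))"

definition u_x :: mpoly where
  "u_x = (\<Sum>i\<in>{1,2,3}. Var (U i) * Var (X i))"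

definition theta :: "mpoly \<Rightarrow> mpoly" where
  "theta f = Const (1/4) * transvectant 2 f f (u_x ^ 2)"

definition Hess :: "mpoly \<Rightarrow> mpoly" where
  "Hess f = Const (1/12) * transvectant 2 f f f"

definition F6u :: "mpoly \<Rightarrow> mpoly" where
  "F6u f = Const (1/3072) * transvectant 2 (theta f) (theta f) (u_x ^ 2)"

definition S_uuu :: "mpoly \<Rightarrow> mpoly" where
  "S_uuu f = Const (1/576) * transvectant 4 (f * u_x) (f * u_x) (f * u_x)"

definition T_uuu :: "mpoly \<Rightarrow> mpoly" where
  "T_uuu f = Const (1/576) * transvectant 4 (f * u_x) (f * u_x) (Hess f * u_x)"

definition monom3 :: "(nat \<Rightarrow> coord) \<Rightarrow> nat \<Rightarrow> nat \<Rightarrow> nat \<Rightarrow> monom" where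
  "monom3 v i j k =
     Poly_Mapping.single (v 1) i + Poly_Mapping.single (v 2) j + Poly_Mapping.single (v 3) k"

text \<open>
  The substitution \<open>u\<^sup>3 \<mapsto> f\<close>, for a cubic form \<open>p\<close> in \<open>u\<^sub>1, u\<^sub>2, u\<^sub>3\<close>: by linearity, the monomial
  \<open>u\<^sub>1\<^sup>i u\<^sub>2\<^sup>j u\<^sub>3\<^sup>k\<close> is sent to \<open>i! j! k! / 3!\<close> times the coefficient of \<open>x\<^sub>1\<^sup>i x\<^sub>2\<^sup>j x\<^sub>3\<^sup>k\<close> in \<open>f\<close>.
\<close>

definition u_cubed_to :: "mpoly \<Rightarrow> mpoly \<Rightarrow> complex" where
  "u_cubed_to f p = (\<Sum>(i,j,k)\<in>{(i,j,k). i + j + k = 3}.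
     coeff p (monom3 U i j k) * (fact i * fact j * fact k / fact 3 * coeff f (monom3 X i j k)))"

definition S_inv :: "mpoly \<Rightarrow> complex" where
  "S_inv f = u_cubed_to f (S_uuu f)"

definition T_inv :: "mpoly \<Rightarrow> complex" where
  "T_inv f = u_cubed_to f (T_uuu f)"

end

theory Submission
  imports "HOL-Computational_Algebra.Fundamental_Theorem_Algebra" Defs
begin

text \<open>
  Every cubic form is a sum of cubes of linear forms, and on such sums all concomitants are symbolic
  products of brackets: \<open>S\<close> and \<open>T\<close> come from one quadrilinear form with value
  \<open>9 [lmn][kmn][lkn][lmk]\<close> on \<open>l\<^sup>3, m\<^sup>3, n\<^sup>3, k\<^sup>3\<close>, and \<open>Hess\<close>, \<open>theta\<close> and \<open>F6u\<close> are
  determinants and minors of matrices of second derivatives.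

  Let \<open>p\<close> be a zero of the Hessian of \<open>f\<close> and \<open>w\<close> a singular point of the polar conic of \<open>p\<close>.
  If \<open>p \<noteq> w\<close>, then \<open>f\<close> splits as \<open>A(x,z) + B(y,z)\<close>, and moving a multiple of \<open>z\<^sup>3\<close> between the
  two binary cubics makes each a sum of two cubes unless \<open>f\<close> has a singular point; a nodal cubic
  splits in the same way. So \<open>f\<close> is a sum of four cubes, or \<open>f = x\<^sup>2 z + g(x,y)\<close>, or \<open>Hess f = 0\<close>.
  For four cubes \<open>S\<close> is the product of the four brackets. If none vanishes, \<open>Hess f\<close> has three
  distinct zeros on the line where the fourth linear form vanishes, so \<open>F6u (Hess f) \<noteq> 0\<close>; if one
  vanishes, three of the cubes form a binary cubic and \<open>f\<close> is a sum of three cubes or cuspidal.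
  Sums of three cubes are excluded by \<open>T = 972 [abc]\<^sup>6\<close>, by \<open>F6u (Hess f) \<noteq> 0\<close>, or by the rank.
\<close>

section \<open>Derivations and substitutions of polynomials\<close>

lemma Const_simps [simp]:
  "Const 0 = 0" "Const 1 = 1" "Const (numeral n) = numeral n" "Const (of_nat k) = of_nat k"
  by (simp_all add: Const_def)

lemma Const_hom:
  "Const (a + b) = Const a + Const b" "Const (a - b) = Const a - Const b"
  "Const (- a) = - Const a" "Const (a * b) = Const a * Const b"
  by (simp_all add: Const_def single_add single_diff single_uminus mult_single)

lemma Const_power: "Const (a ^ n) = Const a ^ n"
  by (induction n) (simp_all add: Const_hom)

lemma Const_eq_iff [simp]: "Const a = Const b \<longleftrightarrow> a = b"
  by (metis Const_def lookup_single_eq)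

lemma Const_eq_0_iff [simp]: "Const a = 0 \<longleftrightarrow> a = 0"
  using Const_eq_iff[of a 0] by simp

section \<open>Additivity and product rules for operators defined by sums over the support\<close>

lemma sum_keys_superset:
  assumes "finite A" "Poly_Mapping.keys p \<subseteq> A" "\<And>m. g m 0 = 0"
  shows "(\<Sum>m\<in>Poly_Mapping.keys p. g m (Poly_Mapping.lookup p m)) = (\<Sum>m\<in>A. g m (Poly_Mapping.lookup p m))"
  by (rule sum.mono_neutral_left) (use assms in \<open>auto simp: in_keys_iff\<close>)

text \<open>Extending all three sums to the union of the two supports adds only zero terms.
  Instances give additivity of \<open>pd\<close> and \<open>subst\<close>.\<close>

lemma sum_keys_add:
  fixes g :: "'a \<Rightarrow> 'b::comm_monoid_add \<Rightarrow> 'c::comm_monoid_add"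
  assumes "\<And>m. g m 0 = 0" "\<And>m a b. g m (a + b) = g m a + g m b"
  shows "(\<Sum>m\<in>Poly_Mapping.keys (p + q). g m (Poly_Mapping.lookup (p + q) m)) =
    (\<Sum>m\<in>Poly_Mapping.keys p. g m (Poly_Mapping.lookup p m)) +
    (\<Sum>m\<in>Poly_Mapping.keys q. g m (Poly_Mapping.lookup q m))"
proof -
  let ?A = "Poly_Mapping.keys p \<union> Poly_Mapping.keys q"
  have "Poly_Mapping.keys (p + q) \<subseteq> ?A"
    by (rule keys_add)
  then have "(\<Sum>m\<in>Poly_Mapping.keys r. g m (Poly_Mapping.lookup r m)) =
      (\<Sum>m\<in>?A. g m (Poly_Mapping.lookup r m))" if "r \<in> {p, q, p + q}" for r
    using that by (intro sum_keys_superset) (auto simp: assms)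
  from this[of p] this[of q] this[of "p + q"] show ?thesis
    by (simp add: assms lookup_add sum.distrib)
qed

lemma pd_add: "pd v (p + q) = pd v p + pd v q"
  unfolding pd_def coeff_def
  by (rule sum_keys_add) (simp_all add: distrib_left single_add)

lemma pd_single:
  "pd v (Poly_Mapping.single m c) =
    Poly_Mapping.single (m - Poly_Mapping.single v 1) (of_nat (expo m v) * c)"
  by (cases "c = 0") (simp_all add: pd_def coeff_def)

lemma subst_add: "subst \<sigma> (p + q) = subst \<sigma> p + subst \<sigma> q"
  unfolding subst_def coeff_def
  by (rule sum_keys_add) (simp_all add: Const_hom distrib_right)

lemma subst_single:
  "subst \<sigma> (Poly_Mapping.single m c) = Const c * (\<Prod>v\<in>Poly_Mapping.keys m. \<sigma> v ^ expo m v)"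
  by (cases "c = 0") (simp_all add: subst_def coeff_def)

lemma additive_diff:
  fixes h :: "'a::ab_group_add \<Rightarrow> 'b::ab_group_add"
  assumes "\<And>p q. h (p + q) = h p + h q"
  shows "h 0 = 0" "h (- p) = - h p" "h (p - q) = h p - h q"
proof -
  show *: "h 0 = 0"
    using assms[of 0 0] by simp
  show m: "h (- p) = - h p" for p
    using assms[of p "- p"] * by (simp add: eq_neg_iff_add_eq_0 add.commute)
  show "h (p - q) = h p - h q"
    using assms[of p "- q"] m[of q] by simp
qed

lemmas pd_diff = additive_diff[of "pd v" for v, OF pd_add]
lemmas subst_diff = additive_diff[of "subst \<sigma>" for \<sigma>, OF subst_add]

lemma mpoly_single_induct [case_names single add]:
  fixes p :: mpoly
  assumes "\<And>m c. P (Poly_Mapping.single m c)" "\<And>p q. P p \<Longrightarrow> P q \<Longrightarrow> P (p + q)"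
  shows "P p"
proof (induction p rule: update_induct)
  case const
  show ?case using assms(1)[of 0 0] by simp
next
  case (update p a b)
  have "Poly_Mapping.update a b p = p + Poly_Mapping.single a b"
    using update by (intro poly_mapping_eqI)
      (auto simp: lookup_update lookup_add lookup_single in_keys_iff when_def)
  then show ?case using assms update by simp
qed

text \<open>Subtraction of exponents truncates at 0, so \<open>v\<close> has to occur in
  \<open>m\<close>; in the product rule the excluded case carries the coefficient 0.\<close>

lemma single_minus_single_add:
  fixes m n :: monom
  assumes "expo m v \<noteq> 0"
  shows "m - Poly_Mapping.single v 1 + n = (m + n) - Poly_Mapping.single v 1"
  using assms by (intro poly_mapping_eqI)
    (auto simp: lookup_add lookup_minus lookup_single expo_def when_def)

lemma pd_mult_single:
  "pd v (Poly_Mapping.single m c * Poly_Mapping.single n d) =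
    pd v (Poly_Mapping.single m c) * Poly_Mapping.single n d +
    Poly_Mapping.single m c * pd v (Poly_Mapping.single n d)"
proof -
  let ?k = "m + n - Poly_Mapping.single v 1"
  have "pd v (Poly_Mapping.single m c) * Poly_Mapping.single n d = Poly_Mapping.single ?k (of_nat (expo m v) * c * d)"
    by (cases "expo m v = 0") (simp_all add: pd_single mult_single single_minus_single_add[simplified])
  moreover have "Poly_Mapping.single m c * pd v (Poly_Mapping.single n d) = Poly_Mapping.single ?k (of_nat (expo n v) * c * d)"
    by (cases "expo n v = 0")
      (simp_all add: pd_single mult_single single_minus_single_add[of n v m, simplified] add.commute[of m] mult.left_commute mult.assoc)
  moreover have "expo (m + n) v = expo m v + expo n v"
    by (simp add: expo_def lookup_add)
  ultimately show ?thesis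
    by (simp add: mult_single pd_single single_add[symmetric] algebra_simps)
qed

lemma pd_mult: "pd v (p * q) = pd v p * q + p * pd v q"
proof (induction p rule: mpoly_single_induct)
  case (single m c)
  show ?case
  proof (induction q rule: mpoly_single_induct)
    case (single n d)
    show ?case by (rule pd_mult_single)
  qed (simp add: pd_add distrib_left)
qed (simp add: pd_add distrib_right)

lemma subst_mult_single:
  "subst \<sigma> (Poly_Mapping.single m c * Poly_Mapping.single n d) =
    subst \<sigma> (Poly_Mapping.single m c) * subst \<sigma> (Poly_Mapping.single n d)"
proof -
  let ?A = "Poly_Mapping.keys m \<union> Poly_Mapping.keys n"
  have prod: "(\<Prod>v\<in>Poly_Mapping.keys k. \<sigma> v ^ expo k v) = (\<Prod>v\<in>?A. \<sigma> v ^ expo k v)"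
    if "Poly_Mapping.keys k \<subseteq> ?A" for k
    by (rule prod.mono_neutral_left) (use that in \<open>auto simp: in_keys_iff expo_def\<close>)
  have "Poly_Mapping.keys (m + n) \<subseteq> ?A"
    by (rule keys_add)
  then have "subst \<sigma> (Poly_Mapping.single m c * Poly_Mapping.single n d) =
      Const (c * d) * (\<Prod>v\<in>?A. \<sigma> v ^ expo (m + n) v)"
    by (simp only: mult_single subst_single prod)
  also have "\<dots> = (Const c * (\<Prod>v\<in>?A. \<sigma> v ^ expo m v)) * (Const d * (\<Prod>v\<in>?A. \<sigma> v ^ expo n v))"
    by (simp add: Const_hom expo_def lookup_add power_add prod.distrib)
  finally show ?thesis
    by (simp only: subst_single prod[of m] prod[of n] Un_upper1 Un_upper2)
qed

lemma subst_mult: "subst \<sigma> (p * q) = subst \<sigma> p * subst \<sigma> q"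
proof (induction p rule: mpoly_single_induct)
  case (single m c)
  show ?case
  proof (induction q rule: mpoly_single_induct)
    case (single n d)
    show ?case by (rule subst_mult_single)
  qed (simp add: subst_add distrib_left)
qed (simp add: subst_add distrib_right)

lemma pd_Const [simp]: "pd v (Const c) = 0"
  by (simp add: Const_def pd_single expo_def)

lemma pd_numeral [simp]: "pd v (numeral n) = 0" "pd v 1 = 0"
  using pd_Const[of v "numeral n"] pd_Const[of v 1] by simp_all

lemma pd_Var [simp]: "pd v (Var w) = (if v = w then 1 else 0)"
  by (auto simp: Var_def pd_single expo_def lookup_single)

lemma pd_power_Suc: "pd v (p ^ Suc n) = of_nat (Suc n) * p ^ n * pd v p"
  by (induction n) (simp_all add: pd_mult algebra_simps)

lemma subst_Const [simp]: "subst \<sigma> (Const c) = Const c"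
  by (simp add: Const_def subst_single mult_single)

lemma subst_numeral [simp]: "subst \<sigma> (numeral n) = numeral n" "subst \<sigma> 1 = 1"
  using subst_Const[of \<sigma> "numeral n"] subst_Const[of \<sigma> 1] by simp_all

lemma subst_Var [simp]: "subst \<sigma> (Var v) = \<sigma> v"
  by (simp add: Var_def subst_single expo_def)

lemma subst_power: "subst \<sigma> (p ^ n) = subst \<sigma> p ^ n"
  by (induction n) (simp_all add: subst_mult)

lemmas pd_simps = pd_add pd_diff pd_mult
lemmas subst_simps = subst_add subst_diff subst_mult subst_power

text \<open>Constants and variables generate the polynomial ring, so properties stable under sums
  and products need checking only on these generators.\<close>

lemma mpoly_induct [case_names Const Var add mult]:
  fixes p :: mpoly
  assumes C: "\<And>c. P (Const c)" and V: "\<And>v. P (Var v)"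
    and add: "\<And>p q. P p \<Longrightarrow> P q \<Longrightarrow> P (p + q)"
    and mult: "\<And>p q. P p \<Longrightarrow> P q \<Longrightarrow> P (p * q)"
  shows "P p"
proof (induction p rule: mpoly_single_induct)
  case (single m c)
  have mono: "P (Poly_Mapping.single m 1)"
  proof (induction m rule: update_induct)
    case const
    show ?case using C[of 1] by (simp add: Const_def)
  next
    case (update m v k)
    have "P (Poly_Mapping.single (Poly_Mapping.single v j) 1)" for j
    proof (induction j)
      case 0
      show ?case using C[of 1] by (simp add: Const_def)
    next
      case (Suc j)
      have "Poly_Mapping.single (Poly_Mapping.single v (Suc j)) 1 =
          Var v * Poly_Mapping.single (Poly_Mapping.single v j) 1"
        by (simp add: Var_def mult_single single_add[symmetric])
      then show ?case using mult[OF V Suc, of v] by metis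
    qed
    moreover have "Poly_Mapping.update v k m = m + Poly_Mapping.single v k"
      using update by (intro poly_mapping_eqI)
        (auto simp: lookup_update lookup_add lookup_single in_keys_iff when_def)
    moreover have "Poly_Mapping.single (a + b) (1::complex) =
        Poly_Mapping.single a 1 * Poly_Mapping.single b 1" for a b :: monom
      by (simp add: mult_single)
    ultimately show ?case using mult update by metis
  qed
  have "Poly_Mapping.single m c = Const c * Poly_Mapping.single m 1"
    by (simp add: Const_def mult_single)
  then show ?case using mult[OF C mono, of c] by metis
qed (rule add)

lemma pd_commute: "pd v (pd w p) = pd w (pd v p)"
  by (induction p rule: mpoly_induct) (simp_all add: pd_simps algebra_simps)

section \<open>Transvectants\<close>

inductive xu :: "mpoly \<Rightarrow> bool" where
  xu_Const: "xu (Const c)"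
| xu_X: "xu (Var (X i))"
| xu_U: "xu (Var (U i))"
| xu_add: "xu p \<Longrightarrow> xu q \<Longrightarrow> xu (p + q)"
| xu_mult: "xu p \<Longrightarrow> xu q \<Longrightarrow> xu (p * q)"

lemma xu_numeral [simp]: "xu (numeral n)" "xu 0" "xu 1"
  using xu_Const[of "numeral n"] xu_Const[of 0] xu_Const[of 1] by simp_all

lemma xu_diff: "xu p \<Longrightarrow> xu q \<Longrightarrow> xu (p - q)"
  using xu_add[OF _ xu_mult[OF xu_Const[of "-1"]], of p q] by (simp add: Const_hom)

lemma xu_power: "xu p \<Longrightarrow> xu (p ^ n)"
  by (induction n) (simp_all add: xu_mult)

lemmas xu_simps [simp] = xu_Const xu_X xu_U xu_add xu_diff xu_mult xu_power

lemma xu_pd_YZ [simp]: "xu p \<Longrightarrow> pd (Y i) p = 0" "xu p \<Longrightarrow> pd (Z i) p = 0"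
  by (induction rule: xu.induct; simp add: pd_simps)+

lemma xu_pd [simp]: "xu p \<Longrightarrow> xu (pd (X i) p)"
  by (induction rule: xu.induct) (simp_all add: pd_simps)

lemma pd_x_to_y [simp]:
  "xu p \<Longrightarrow> pd (Y i) (x_to_y p) = x_to_y (pd (X i) p)"
  "xu p \<Longrightarrow> pd (X i) (x_to_y p) = 0"
  "xu p \<Longrightarrow> pd (Z i) (x_to_y p) = 0"
  by (induction rule: xu.induct; simp add: x_to_y_def pd_simps subst_simps)+

lemma pd_x_to_z [simp]:
  "xu p \<Longrightarrow> pd (Z i) (x_to_z p) = x_to_z (pd (X i) p)"
  "xu p \<Longrightarrow> pd (X i) (x_to_z p) = 0"
  "xu p \<Longrightarrow> pd (Y i) (x_to_z p) = 0"
  by (induction rule: xu.induct; simp add: x_to_z_def pd_simps subst_simps)+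

lemma yz_to_x_xu [simp]:
  "xu p \<Longrightarrow> yz_to_x p = p"
  "xu p \<Longrightarrow> yz_to_x (x_to_y p) = p"
  "xu p \<Longrightarrow> yz_to_x (x_to_z p) = p"
  by (induction rule: xu.induct; simp add: x_to_y_def x_to_z_def yz_to_x_def subst_simps)+

lemma yz_to_x_hom:
  "yz_to_x (p + q) = yz_to_x p + yz_to_x q" "yz_to_x (p - q) = yz_to_x p - yz_to_x q"
  "yz_to_x (p * q) = yz_to_x p * yz_to_x q" "yz_to_x 0 = 0" "yz_to_x (Const c) = Const c"
  by (simp_all add: yz_to_x_def subst_simps)

section \<open>The operator \<open>Omega\<close> on products f(x) g(y) h(z)\<close>

definition trip :: "mpoly \<Rightarrow> mpoly \<Rightarrow> mpoly \<Rightarrow> mpoly" where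
  "trip f g h = f * x_to_y g * x_to_z h"

lemma yz_to_x_trip [simp]: "xu f \<Longrightarrow> xu g \<Longrightarrow> xu h \<Longrightarrow> yz_to_x (trip f g h) = f * g * h"
  by (simp add: trip_def yz_to_x_hom)

lemma Omega_add: "Omega (p + q) = Omega p + Omega q"
  by (simp add: Omega_def pd_add)

lemmas Omega_diff = additive_diff[of Omega, OF Omega_add]

lemma Omega_mult_const:
  assumes "\<And>i. pd (X i) k = 0" "\<And>i. pd (Y i) k = 0" "\<And>i. pd (Z i) k = 0"
  shows "Omega (k * p) = k * Omega p"
  by (simp add: Omega_def pd_mult assms algebra_simps)

text \<open>Each partial derivative in \<open>Omega\<close> reaches exactly one of the three
  factors, so the result is again a sum of products of the same kind and \<open>Omega\<close> can be
  iterated.\<close>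

lemma Omega_trip:
  assumes "xu f" "xu g" "xu h"
  shows "Omega (trip f g h) =
     trip (pd (X 1) f) (pd (X 2) g) (pd (X 3) h) - trip (pd (X 1) f) (pd (X 3) g) (pd (X 2) h)
   - trip (pd (X 2) f) (pd (X 1) g) (pd (X 3) h) + trip (pd (X 2) f) (pd (X 3) g) (pd (X 1) h)
   + trip (pd (X 3) f) (pd (X 1) g) (pd (X 2) h) - trip (pd (X 3) f) (pd (X 2) g) (pd (X 1) h)"
  using assms by (simp add: Omega_def trip_def pd_mult)

lemma transvectant_additive:
  "transvectant n (f + f') g h = transvectant n f g h + transvectant n f' g h"
  "transvectant n f (g + g') h = transvectant n f g h + transvectant n f g' h"
  "transvectant n f g (h + h') = transvectant n f g h + transvectant n f g h'"
proof -
  have "(Omega ^^ n) (p + q) = (Omega ^^ n) p + (Omega ^^ n) q" for p q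
    by (induction n) (simp_all add: Omega_add)
  then show "transvectant n (f + f') g h = transvectant n f g h + transvectant n f' g h"
    "transvectant n f (g + g') h = transvectant n f g h + transvectant n f g' h"
    "transvectant n f g (h + h') = transvectant n f g h + transvectant n f g h'"
    by (simp_all add: transvectant_def x_to_y_def x_to_z_def yz_to_x_hom subst_add distrib_left distrib_right)
qed

lemma transvectant_scale:
  "transvectant n (Const c * f) g h = Const c * transvectant n f g h"
  "transvectant n f (Const c * g) h = Const c * transvectant n f g h"
  "transvectant n f g (Const c * h) = Const c * transvectant n f g h"
proof -
  have *: "yz_to_x ((Omega ^^ n) (Const c * p)) = Const c * yz_to_x ((Omega ^^ n) p)" for p
    by (induction n arbitrary: p) (simp_all add: Omega_mult_const yz_to_x_hom funpow_swap1)
  show "transvectant n (Const c * f) g h = Const c * transvectant n f g h"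
    "transvectant n f (Const c * g) h = Const c * transvectant n f g h"
    "transvectant n f g (Const c * h) = Const c * transvectant n f g h"
    by (simp_all add: transvectant_def x_to_y_def x_to_z_def subst_mult *[symmetric] ac_simps)
qed

section \<open>Second transvectants as minors of matrices of second derivatives\<close>

definition Hm :: "mpoly \<Rightarrow> nat \<Rightarrow> nat \<Rightarrow> mpoly" where
  "Hm f i j = pd (X i) (pd (X j) f)"

definition sdet :: "(nat \<Rightarrow> nat \<Rightarrow> 'a::comm_ring_1) \<Rightarrow> 'a" where
  "sdet H = H 1 1 * (H 2 2 * H 3 3 - (H 2 3)\<^sup>2) - H 2 2 * (H 1 3)\<^sup>2 - H 3 3 * (H 1 2)\<^sup>2
    + 2 * H 1 2 * H 1 3 * H 2 3"

text \<open>The quadratic form of the adjugate matrix. Like \<open>sdet\<close>, it reads only the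
  diagonal and the upper triangle, so symmetry of \<open>H\<close> is built in.\<close>

definition qadj :: "(nat \<Rightarrow> nat \<Rightarrow> 'a::comm_ring_1) \<Rightarrow> (nat \<Rightarrow> 'a) \<Rightarrow> 'a" where
  "qadj H u = (H 2 2 * H 3 3 - (H 2 3)\<^sup>2) * (u 1)\<^sup>2 + (H 1 1 * H 3 3 - (H 1 3)\<^sup>2) * (u 2)\<^sup>2
    + (H 1 1 * H 2 2 - (H 1 2)\<^sup>2) * (u 3)\<^sup>2
    + 2 * (H 1 3 * H 2 3 - H 1 2 * H 3 3) * u 1 * u 2
    + 2 * (H 1 2 * H 2 3 - H 1 3 * H 2 2) * u 1 * u 3
    + 2 * (H 1 2 * H 1 3 - H 1 1 * H 2 3) * u 2 * u 3"

text \<open>The right-hand side is twice the trace of the adjugate of \<open>Hm f\<close> times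
  \<open>Hm h\<close>. It becomes a multiple of \<open>sdet (Hm f)\<close> for \<open>h = f\<close>
  and of \<open>qadj (Hm f)\<close> for \<open>h = u_x ^ 2\<close>.\<close>

lemma transvectant_2:
  assumes "xu f" "xu h"
  shows "transvectant 2 f f h = 2 * (
      (Hm f 2 2 * Hm f 3 3 - (Hm f 2 3)\<^sup>2) * Hm h 1 1 + (Hm f 1 1 * Hm f 3 3 - (Hm f 1 3)\<^sup>2) * Hm h 2 2
    + (Hm f 1 1 * Hm f 2 2 - (Hm f 1 2)\<^sup>2) * Hm h 3 3
    + 2 * (Hm f 1 3 * Hm f 2 3 - Hm f 1 2 * Hm f 3 3) * Hm h 1 2
    + 2 * (Hm f 1 2 * Hm f 2 3 - Hm f 1 3 * Hm f 2 2) * Hm h 1 3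
    + 2 * (Hm f 1 2 * Hm f 1 3 - Hm f 1 1 * Hm f 2 3) * Hm h 2 3)"
proof -
  have "transvectant 2 f f h = yz_to_x (Omega (Omega (trip f f h)))"
    by (simp add: transvectant_def trip_def numeral_2_eq_2)
  then show ?thesis
    using assms
    by (simp add: Omega_trip Omega_add Omega_diff yz_to_x_hom)
       (simp add: Hm_def pd_commute[of "X 2" "X 1"] pd_commute[of "X 3" "X 1"] pd_commute[of "X 3" "X 2"]
         pd_commute[of "X 2" "X (Suc 0)"] pd_commute[of "X 3" "X (Suc 0)"]
         algebra_simps power2_eq_square)
qed

lemma u_x_eq: "u_x = Var (U 1) * Var (X 1) + Var (U 2) * Var (X 2) + Var (U 3) * Var (X 3)"
  by (simp add: u_x_def)

lemma xu_u_x [simp]: "xu u_x"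
  by (simp add: u_x_eq)

lemma Hm_u_x_squared: "i \<in> {1,2,3} \<Longrightarrow> j \<in> {1,2,3} \<Longrightarrow> Hm (u_x ^ 2) i j = 2 * Var (U i) * Var (U j)"
  by (auto simp: Hm_def u_x_eq pd_simps power2_eq_square algebra_simps)

lemma theta_eq: "xu f \<Longrightarrow> theta f = qadj (Hm f) (\<lambda>i. Var (U i))"
proof -
  assume "xu f"
  have *: "theta f = Const (1/4) * (4 * qadj (Hm f) (\<lambda>i. Var (U i)))"
    unfolding theta_def transvectant_2[OF \<open>xu f\<close> xu_power[OF xu_u_x]]
    by (simp add: Hm_u_x_squared) (simp add: qadj_def algebra_simps power2_eq_square)
  have "Const (1/4) * 4 = 1"
    by (simp flip: Const_simps Const_hom)
  then show ?thesis
    unfolding * by (simp only: mult.assoc[symmetric] mult_1_left)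
qed

lemma Hess_eq: "xu f \<Longrightarrow> Hess f = Const (1/2) * sdet (Hm f)"
proof -
  assume "xu f"
  have *: "Hess f = Const (1/12) * (6 * sdet (Hm f))"
    unfolding Hess_def transvectant_2[OF \<open>xu f\<close> \<open>xu f\<close>]
    by (simp add: sdet_def algebra_simps power2_eq_square)
  have "Const (1/12) * 6 = Const (1/2)"
    by (simp flip: Const_simps Const_hom)
  then show ?thesis
    unfolding * by (simp only: mult.assoc[symmetric])
qed

lemma xu_Hm [simp]: "xu f \<Longrightarrow> xu (Hm f i j)"
  by (simp add: Hm_def)

lemma xu_theta [simp]: "xu f \<Longrightarrow> xu (theta f)"
  by (simp add: theta_eq qadj_def)

lemma xu_Hess [simp]: "xu f \<Longrightarrow> xu (Hess f)"
  by (simp add: Hess_eq sdet_def)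

lemma F6u_eq: "xu f \<Longrightarrow> F6u f = Const (1/768) * qadj (Hm (theta f)) (\<lambda>i. Var (U i))"
proof -
  assume "xu f"
  have *: "F6u f = Const (1/3072) * (4 * qadj (Hm (theta f)) (\<lambda>i. Var (U i)))"
    unfolding F6u_def transvectant_2[OF xu_theta[OF \<open>xu f\<close>] xu_power[OF xu_u_x]]
    by (simp add: Hm_u_x_squared) (simp add: qadj_def algebra_simps power2_eq_square)
  have "Const (1/3072) * 4 = Const (1/768)"
    by (simp flip: Const_simps Const_hom)
  then show ?thesis
    unfolding * by (simp only: mult.assoc[symmetric])
qed

section \<open>Fourth transvectants of cubes of linear forms times \<open>u_x\<close>\<close>

definition lin :: "(nat \<Rightarrow> complex) \<Rightarrow> mpoly" where
  "lin l = Const (l 1) * Var (X 1) + Const (l 2) * Var (X 2) + Const (l 3) * Var (X 3)"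

text \<open>The ring of entries is general so that the indeterminate vector \<open>uu\<close> can
  stand beside constant vectors.\<close>

definition br :: "(nat \<Rightarrow> 'a::comm_ring_1) \<Rightarrow> (nat \<Rightarrow> 'a) \<Rightarrow> (nat \<Rightarrow> 'a) \<Rightarrow> 'a" where
  "br a b c = a 1 * (b 2 * c 3 - b 3 * c 2) - a 2 * (b 1 * c 3 - b 3 * c 1) + a 3 * (b 1 * c 2 - b 2 * c 1)"

lemma xu_lin [simp]: "xu (lin l)"
  by (simp add: lin_def)

lemma pd_lin: "i \<in> {1,2,3} \<Longrightarrow> pd (X i) (lin l) = Const (l i)"
  by (auto simp: lin_def pd_simps)

lemma pd_u_x: "i \<in> {1,2,3} \<Longrightarrow> pd (X i) u_x = Var (U i)"
  by (auto simp: u_x_eq pd_simps)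

abbreviation uu :: "nat \<Rightarrow> mpoly" where
  "uu \<equiv> \<lambda>i. Var (U i)"

abbreviation cc :: "(nat \<Rightarrow> complex) \<Rightarrow> nat \<Rightarrow> mpoly" where
  "cc l \<equiv> \<lambda>i. Const (l i)"

text \<open>Up to coefficients free of \<open>x\<close>, these products are closed under
  \<open>x\<close>-derivatives; they are what remains of \<open>lin l ^ 3 * u_x\<close> in each slot
  under repeated \<open>Omega\<close>.\<close>

definition linu :: "nat \<Rightarrow> nat \<Rightarrow> (nat \<Rightarrow> complex) \<Rightarrow> mpoly" where
  "linu a b l = lin l ^ a * u_x ^ b"

lemma xu_linu [simp]: "xu (linu a b l)"
  by (simp add: linu_def)

lemma pd_power: "pd v (p ^ n) = of_nat n * p ^ (n - 1) * pd v p"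
  by (cases n) (simp_all add: pd_power_Suc del: power_Suc of_nat_Suc)

text \<open>At exponent 0 the truncated subtraction is harmless, as the factor
  \<open>of_nat a\<close> or \<open>of_nat b\<close> is then 0.\<close>

lemma pd_linu:
  assumes "i \<in> {1,2,3}"
  shows "pd (X i) (linu a b l) =
    of_nat a * Const (l i) * linu (a - 1) b l + of_nat b * uu i * linu a (b - 1) l"
  using assms by (simp only: linu_def pd_mult pd_power pd_lin pd_u_x) (simp add: algebra_simps)

text \<open>Constants and the \<open>U i\<close> are fixed by both renamings of variables, so such
  coefficients come out of all three slots.\<close>

lemma trip_expand:
  assumes "\<And>k. k \<in> {a1, b1, a2, b2, a3, b3} \<Longrightarrow> x_to_y k = k \<and> x_to_z k = k"
  shows "trip (a1 * p1 + b1 * q1) (a2 * p2 + b2 * q2) (a3 * p3 + b3 * q3) =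
      (a1 * a2 * a3) * trip p1 p2 p3 + (b1 * a2 * a3) * trip q1 p2 p3
    + (a1 * b2 * a3) * trip p1 q2 p3 + (a1 * a2 * b3) * trip p1 p2 q3
    + (b1 * b2 * a3) * trip q1 q2 p3 + (b1 * a2 * b3) * trip q1 p2 q3
    + (a1 * b2 * b3) * trip p1 q2 q3 + (b1 * b2 * b3) * trip q1 q2 q3"
proof -
  have "x_to_y (a2 * p2 + b2 * q2) = a2 * x_to_y p2 + b2 * x_to_y q2"
    "x_to_z (a3 * p3 + b3 * q3) = a3 * x_to_z p3 + b3 * x_to_z q3"
    using assms[of a2] assms[of b2] assms[of a3] assms[of b3]
    by (simp_all add: x_to_y_def x_to_z_def subst_simps)
  then show ?thesis
    by (simp only: trip_def) (simp add: algebra_simps)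
qed

lemma trip_pd_linu:
  assumes "i \<in> {1,2,3}" "j \<in> {1,2,3}" "k \<in> {1,2,3}"
  shows "trip (pd (X i) (linu a a' l)) (pd (X j) (linu b b' m)) (pd (X k) (linu c c' n)) =
    of_nat (a * b * c) * (cc l i * cc m j * cc n k) * trip (linu (a-1) a' l) (linu (b-1) b' m) (linu (c-1) c' n)
  + of_nat (a' * b * c) * (uu i * cc m j * cc n k) * trip (linu a (a'-1) l) (linu (b-1) b' m) (linu (c-1) c' n)
  + of_nat (a * b' * c) * (cc l i * uu j * cc n k) * trip (linu (a-1) a' l) (linu b (b'-1) m) (linu (c-1) c' n)
  + of_nat (a * b * c') * (cc l i * cc m j * uu k) * trip (linu (a-1) a' l) (linu (b-1) b' m) (linu c (c'-1) n)
  + of_nat (a' * b' * c) * (uu i * uu j * cc n k) * trip (linu a (a'-1) l) (linu b (b'-1) m) (linu (c-1) c' n)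
  + of_nat (a' * b * c') * (uu i * cc m j * uu k) * trip (linu a (a'-1) l) (linu (b-1) b' m) (linu c (c'-1) n)
  + of_nat (a * b' * c') * (cc l i * uu j * uu k) * trip (linu (a-1) a' l) (linu b (b'-1) m) (linu c (c'-1) n)
  + of_nat (a' * b' * c') * (uu i * uu j * uu k) * trip (linu a (a'-1) l) (linu b (b'-1) m) (linu c (c'-1) n)"
proof -
  have K: "x_to_y (of_nat p * k) = of_nat p * k \<and> x_to_z (of_nat p * k) = of_nat p * k"
    if "\<exists>r. k = uu r \<or> (\<exists>z. k = Const z)" for p k
    using that subst_Const[of _ "of_nat p"] by (auto simp: x_to_y_def x_to_z_def subst_simps)
  show ?thesis
    unfolding pd_linu[OF assms(1)] pd_linu[OF assms(2)] pd_linu[OF assms(3)]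
    by (subst trip_expand) (auto intro!: K simp: mult_ac)
qed

text \<open>The alternating sum over the indices turns the eight coefficients of
  \<open>trip_pd_linu\<close> into brackets; the four with at least two entries \<open>uu\<close>
  vanish.\<close>

lemma Omega_trip_linu:
  "Omega (trip (linu a a' l) (linu b b' m) (linu c c' n)) =
    of_nat (a * b * c) * br (cc l) (cc m) (cc n) * trip (linu (a-1) a' l) (linu (b-1) b' m) (linu (c-1) c' n)
  + of_nat (a' * b * c) * br uu (cc m) (cc n) * trip (linu a (a'-1) l) (linu (b-1) b' m) (linu (c-1) c' n)
  + of_nat (a * b' * c) * br (cc l) uu (cc n) * trip (linu (a-1) a' l) (linu b (b'-1) m) (linu (c-1) c' n)
  + of_nat (a * b * c') * br (cc l) (cc m) uu * trip (linu (a-1) a' l) (linu (b-1) b' m) (linu c (c'-1) n)"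
  by (simp add: Omega_trip trip_pd_linu del: of_nat_mult) (simp add: br_def algebra_simps)

lemma Omega_const_mult [simp]:
  "Omega (br (cc l) (cc m) (cc n) * p) = br (cc l) (cc m) (cc n) * Omega p"
  "Omega (br uu (cc m) (cc n) * p) = br uu (cc m) (cc n) * Omega p"
  "Omega (br (cc l) uu (cc n) * p) = br (cc l) uu (cc n) * Omega p"
  "Omega (br (cc l) (cc m) uu * p) = br (cc l) (cc m) uu * Omega p"
  "Omega (numeral k * p) = numeral k * Omega p"
  by (rule Omega_mult_const; simp add: br_def pd_simps)+

text \<open>
  A bracket with two entries \<open>u\<close> vanishes, so exactly three of the four factors \<open>\<Omega>\<close> differentiate
  some \<open>u_x\<close>, once in each of the three arguments; the orderings and the derivatives of the cubes
  give the factor \<open>4! (3!)\<^sup>3 = 5184\<close>.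
\<close>

lemma transvectant_4_cubes:
  "transvectant 4 (lin l ^ 3 * u_x) (lin m ^ 3 * u_x) (lin n ^ 3 * u_x) =
    5184 * (br (cc l) (cc m) (cc n) * br uu (cc m) (cc n) * br (cc l) uu (cc n) * br (cc l) (cc m) uu)"
proof -
  have "transvectant 4 (lin l ^ 3 * u_x) (lin m ^ 3 * u_x) (lin n ^ 3 * u_x) =
     yz_to_x (Omega (Omega (Omega (Omega (trip (linu 3 1 l) (linu 3 1 m) (linu 3 1 n))))))"
    by (simp add: transvectant_def trip_def eval_nat_numeral linu_def)
  also have "Omega (Omega (Omega (Omega (trip (linu 3 1 l) (linu 3 1 m) (linu 3 1 n))))) =
      5184 * (br (cc l) (cc m) (cc n) * br uu (cc m) (cc n) * br (cc l) uu (cc n) * br (cc l) (cc m) uu)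
        * trip 1 1 1"
    by (simp add: Omega_trip_linu Omega_add mult.assoc) (simp add: algebra_simps linu_def)
  also have "yz_to_x \<dots> = 5184 * (br (cc l) (cc m) (cc n) * br uu (cc m) (cc n) * br (cc l) uu (cc n) * br (cc l) (cc m) uu)"
    by (simp add: br_def trip_def x_to_y_def x_to_z_def yz_to_x_def subst_simps)
  finally show ?thesis .
qed

section \<open>Substituting a cubic for the cubic monomials in \<open>u\<close>\<close>

lemma coeff_hom:
  "coeff (p + q) m = coeff p m + coeff q m"
  "coeff (Const c * p) m = c * coeff p m"
proof -
  show "coeff (p + q) m = coeff p m + coeff q m"
    by (simp add: coeff_def lookup_add)
  have "Const c * p = Poly_Mapping.map ((*) c) p"
    by (simp add: Const_def mult_map_scale_conv_mult)
  then show "coeff (Const c * p) m = c * coeff p m"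
    by (simp add: coeff_def map.rep_eq when_def)
qed

lemma u_cubed_to_hom:
  "u_cubed_to f (p + q) = u_cubed_to f p + u_cubed_to f q"
  "u_cubed_to (f + g) p = u_cubed_to f p + u_cubed_to g p"
  "u_cubed_to f (Const c * p) = c * u_cubed_to f p"
  "u_cubed_to (Const c * f) p = c * u_cubed_to f p"
  unfolding u_cubed_to_def coeff_hom case_prod_unfold
  by (simp_all add: sum.distrib sum_distrib_left add_divide_distrib algebra_simps)

lemma exponent_cases:
  assumes "i + j + k = (3::nat)"
  shows "i = 0 \<or> i = 1 \<or> i = 2 \<or> i = 3" "j = 0 \<or> j = 1 \<or> j = 2 \<or> j = 3" "k = 3 - i - j"
  using assms by arith+

lemma exponents_3: "{(i,j,k). i + j + k = (3::nat)} =
    {(3,0,0),(0,3,0),(0,0,3),(2,1,0),(2,0,1),(1,2,0),(0,2,1),(1,0,2),(0,1,2),(1,1,1)}" (is "_ = ?S")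
proof (rule equalityI)
  have *: "(i,j,k) \<in> ?S"
    if "i + j + k = 3" "i = 0 \<or> i = 1 \<or> i = 2 \<or> i = 3" "j = 0 \<or> j = 1 \<or> j = 2 \<or> j = 3" "k = 3 - i - j"
    for i j k :: nat
    using that(2-) that(1) by (elim disjE) simp_all
  show "{(i,j,k). i + j + k = 3} \<subseteq> ?S"
  proof (rule subsetI)
    fix t :: "nat \<times> nat \<times> nat"
    assume "t \<in> {(i,j,k). i + j + k = 3}"
    then obtain i j k where "t = (i,j,k)" "i + j + k = 3"
      by blast
    then show "t \<in> ?S"
      using *[OF _ exponent_cases] by (simp only:)
  qed
qed simp

definition mon :: "(nat \<Rightarrow> coord) \<Rightarrow> nat \<Rightarrow> nat \<Rightarrow> nat \<Rightarrow> mpoly" where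
  "mon v i j k = Var (v 1) ^ i * Var (v 2) ^ j * Var (v 3) ^ k"

lemma Var_power: "Var v ^ n = Poly_Mapping.single (Poly_Mapping.single v n) 1"
  by (induction n) (simp_all add: Var_def mult_single single_add[symmetric])

lemma mon_eq: "mon v i j k = Poly_Mapping.single (monom3 v i j k) 1"
  by (simp add: mon_def monom3_def Var_power mult_single)

lemma monom3_eq_iff:
  assumes "v = X \<or> v = U"
  shows "monom3 v i j k = monom3 v i' j' k' \<longleftrightarrow> i = i' \<and> j = j' \<and> k = k'"
proof
  assume eq: "monom3 v i j k = monom3 v i' j' k'"
  have "expo (monom3 v i j k) (v n) = expo (monom3 v i' j' k') (v n)" for n
    by (simp add: eq)
  from this[of 1] this[of 2] this[of 3] show "i = i' \<and> j = j' \<and> k = k'"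
    using assms by (auto simp: monom3_def expo_def lookup_add lookup_single)
qed simp

lemma coeff_mon:
  "v = X \<or> v = U \<Longrightarrow> coeff (mon v i j k) (monom3 v i' j' k') = (if i = i' \<and> j = j' \<and> k = k' then 1 else 0)"
  by (auto simp: mon_eq coeff_def lookup_single monom3_eq_iff when_def)

lemma lin_cube:
  "lin l ^ 3 = Const (l 1 ^ 3) * mon X 3 0 0 + Const (l 2 ^ 3) * mon X 0 3 0 + Const (l 3 ^ 3) * mon X 0 0 3
   + Const (3 * l 1 ^ 2 * l 2) * mon X 2 1 0 + Const (3 * l 1 ^ 2 * l 3) * mon X 2 0 1
   + Const (3 * l 1 * l 2 ^ 2) * mon X 1 2 0 + Const (3 * l 2 ^ 2 * l 3) * mon X 0 2 1
   + Const (3 * l 1 * l 3 ^ 2) * mon X 1 0 2 + Const (3 * l 2 * l 3 ^ 2) * mon X 0 1 2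
   + Const (6 * l 1 * l 2 * l 3) * mon X 1 1 1"
  by (simp add: lin_def mon_def Const_hom Const_power power2_eq_square power3_eq_cube algebra_simps)

text \<open>The factor i! j! k! / 3! in \<open>u_cubed_to\<close> cancels the multinomial
  coefficients of a cube, so substituting \<open>lin l ^ 3\<close> evaluates a cubic in
  \<open>u\<close> at the vector \<open>l\<close>.\<close>

lemma u_cubed_to_mon:
  assumes "i + j + k = 3"
  shows "u_cubed_to (lin l ^ 3) (mon U i j k) = l 1 ^ i * l 2 ^ j * l 3 ^ k"
proof -
  have "(i, j, k) \<in> {(i,j,k). i + j + k = 3}"
    using assms by simp
  then show ?thesis
    unfolding u_cubed_to_def exponents_3
    by (auto simp: lin_cube coeff_hom coeff_mon fact_numeral)
qed

lemma linu_product: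
  "(Const a1 * uu 1 + Const a2 * uu 2 + Const a3 * uu 3) * (Const b1 * uu 1 + Const b2 * uu 2 + Const b3 * uu 3)
     * (Const c1 * uu 1 + Const c2 * uu 2 + Const c3 * uu 3) =
   Const (a1*b1*c1) * mon U 3 0 0 + Const (a2*b2*c2) * mon U 0 3 0 + Const (a3*b3*c3) * mon U 0 0 3
   + Const (a1*b1*c2 + a1*b2*c1 + a2*b1*c1) * mon U 2 1 0 + Const (a1*b1*c3 + a1*b3*c1 + a3*b1*c1) * mon U 2 0 1
   + Const (a1*b2*c2 + a2*b2*c1 + a2*b1*c2) * mon U 1 2 0 + Const (a2*b2*c3 + a2*b3*c2 + a3*b2*c2) * mon U 0 2 1
   + Const (a1*b3*c3 + a3*b3*c1 + a3*b1*c3) * mon U 1 0 2 + Const (a2*b3*c3 + a3*b3*c2 + a3*b2*c3) * mon U 0 1 2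
   + Const (a1*b2*c3 + a1*b3*c2 + a2*b1*c3 + a2*b3*c1 + a3*b1*c2 + a3*b2*c1) * mon U 1 1 1"
  by (simp add: mon_def Const_hom power2_eq_square power3_eq_cube algebra_simps)

lemma u_cubed_to_product:
  "u_cubed_to (lin k ^ 3) ((Const a1 * uu 1 + Const a2 * uu 2 + Const a3 * uu 3) * (Const b1 * uu 1 + Const b2 * uu 2 + Const b3 * uu 3)
     * (Const c1 * uu 1 + Const c2 * uu 2 + Const c3 * uu 3)) =
   (a1 * k 1 + a2 * k 2 + a3 * k 3) * (b1 * k 1 + b2 * k 2 + b3 * k 3) * (c1 * k 1 + c2 * k 2 + c3 * k 3)"
  by (simp only: linu_product u_cubed_to_hom) (simp add: u_cubed_to_mon,
    simp add: power2_eq_square power3_eq_cube algebra_simps)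

text \<open>The common polarisation of \<open>S_inv\<close> and \<open>T_inv\<close>: being linear
  in each argument, it is determined on cubic forms by its values on cubes.\<close>

definition S4 :: "mpoly \<Rightarrow> mpoly \<Rightarrow> mpoly \<Rightarrow> mpoly \<Rightarrow> complex" where
  "S4 f g h k = u_cubed_to k (Const (1/576) * transvectant 4 (f * u_x) (g * u_x) (h * u_x))"

lemma S_inv_eq: "S_inv f = S4 f f f f"
  by (simp add: S_inv_def S_uuu_def S4_def)

lemma T_inv_eq: "T_inv f = S4 f f (Hess f) f"
  by (simp add: T_inv_def T_uuu_def S4_def)

lemma S4_additive:
  "S4 (f + f') g h k = S4 f g h k + S4 f' g h k"
  "S4 f (g + g') h k = S4 f g h k + S4 f g' h k"
  "S4 f g (h + h') k = S4 f g h k + S4 f g h' k"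
  "S4 f g h (k + k') = S4 f g h k + S4 f g h k'"
  by (simp_all add: S4_def distrib_right distrib_left transvectant_additive u_cubed_to_hom)

lemma S4_scale:
  "S4 (Const c * f) g h k = c * S4 f g h k"
  "S4 f (Const c * g) h k = c * S4 f g h k"
  "S4 f g (Const c * h) k = c * S4 f g h k"
  "S4 f g h (Const c * k) = c * S4 f g h k"
  by (simp_all add: S4_def mult.assoc transvectant_scale u_cubed_to_hom)

text \<open>The transvectant leaves \<open>br l m n\<close> times three brackets linear in
  \<open>u\<close>, which the substitution evaluates at \<open>k\<close>. The constant is 5184/576 =
  9.\<close>

lemma S4_cubes:
  "S4 (lin l ^ 3) (lin m ^ 3) (lin n ^ 3) (lin k ^ 3) = 9 * br l m n * br k m n * br l k n * br l m k"
proof -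
  \<comment> \<open>The triples \<open>a1 a2 a3\<close>, \<open>b1 b2 b3\<close>,
    \<open>c1 c2 c3\<close> are the coefficients in \<open>u\<close> of the three brackets that
    contain \<open>u\<close>.\<close>
  define a1 where "a1 = m 2 * n 3 - m 3 * n 2" define a2 where "a2 = m 3 * n 1 - m 1 * n 3"
  define a3 where "a3 = m 1 * n 2 - m 2 * n 1"
  define b1 where "b1 = n 2 * l 3 - n 3 * l 2" define b2 where "b2 = n 3 * l 1 - n 1 * l 3"
  define b3 where "b3 = n 1 * l 2 - n 2 * l 1"
  define c1 where "c1 = l 2 * m 3 - l 3 * m 2" define c2 where "c2 = l 3 * m 1 - l 1 * m 3"
  define c3 where "c3 = l 1 * m 2 - l 2 * m 1"
  have *: "Const (1/576) * transvectant 4 (lin l ^ 3 * u_x) (lin m ^ 3 * u_x) (lin n ^ 3 * u_x) =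
    Const (9 * br l m n) * ((Const a1 * uu 1 + Const a2 * uu 2 + Const a3 * uu 3) * (Const b1 * uu 1 + Const b2 * uu 2 + Const b3 * uu 3)
     * (Const c1 * uu 1 + Const c2 * uu 2 + Const c3 * uu 3))" (is "_ = _ * (?a * ?b * ?c)")
  proof -
    have "br uu (cc m) (cc n) = ?a" "br (cc l) uu (cc n) = ?b" "br (cc l) (cc m) uu = ?c"
      by (simp_all add: br_def a1_def a2_def a3_def b1_def b2_def b3_def c1_def c2_def c3_def Const_hom algebra_simps)
    moreover have "br (cc l) (cc m) (cc n) = Const (br l m n)"
      by (simp add: br_def Const_hom)
    moreover have "Const (9 * br l m n) = Const (1/576) * (5184 * Const (br l m n))"
      by (simp flip: Const_simps Const_hom)
    ultimately show ?thesis
      by (simp only: transvectant_4_cubes mult.assoc)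
  qed
  have "br k m n = a1 * k 1 + a2 * k 2 + a3 * k 3" "br l k n = b1 * k 1 + b2 * k 2 + b3 * k 3"
    "br l m k = c1 * k 1 + c2 * k 2 + c3 * k 3"
    by (simp_all add: br_def a1_def a2_def a3_def b1_def b2_def b3_def c1_def c2_def c3_def algebra_simps)
  then show ?thesis
    unfolding S4_def * u_cubed_to_hom u_cubed_to_product by (simp add: mult.assoc)
qed

section \<open>Linear forms and sums of cubes\<close>

definition ev :: "nat \<Rightarrow> nat \<Rightarrow> complex" where
  "ev n i = (if i = n then 1 else 0)"

definition comb :: "(nat \<Rightarrow> complex) \<Rightarrow> (nat \<Rightarrow> complex) \<Rightarrow> (nat \<Rightarrow> complex) \<Rightarrow> complex \<Rightarrow> complex \<Rightarrow> complex \<Rightarrow> nat \<Rightarrow> complex" where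
  "comb a b c p q r i = p * a i + q * b i + r * c i"

lemma lin_comb: "lin (comb a b c p q r) = Const p * lin a + Const q * lin b + Const r * lin c"
  by (simp add: lin_def comb_def Const_hom algebra_simps)

lemma lin_ev: "lin (ev 1) = Var (X 1)" "lin (ev 2) = Var (X 2)" "lin (ev 3) = Var (X 3)"
  by (simp_all add: lin_def ev_def)

lemma lin_scale: "lin (\<lambda>i. k * a i) = Const k * lin a"
  by (simp add: lin_def Const_hom algebra_simps)

lemma lin_cong: "a 1 = b 1 \<Longrightarrow> a 2 = b 2 \<Longrightarrow> a 3 = b 3 \<Longrightarrow> lin a = lin b"
  by (simp add: lin_def)

lemma br_comb:
  "br (comb a b c p1 q1 r1) (comb a b c p2 q2 r2) (comb a b c p3 q3 r3) =
   (p1 * (q2 * r3 - r2 * q3) - q1 * (p2 * r3 - r2 * p3) + r1 * (p2 * q3 - q2 * p3)) * br a b c"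
  by (simp add: br_def comb_def algebra_simps)

lemma lin_eq_0_iff: "lin a = 0 \<longleftrightarrow> a 1 = 0 \<and> a 2 = 0 \<and> a 3 = 0"
proof
  assume "lin a = 0"
  then have "subst (\<lambda>v. if v = X n then 1 else 0) (lin a) = 0" for n
    by (simp add: subst_diff)
  from this[of 1] this[of 2] this[of 3] show "a 1 = 0 \<and> a 2 = 0 \<and> a 3 = 0"
    by (simp_all add: lin_def subst_simps)
qed (simp add: lin_def)

section \<open>Forms as combinations of monomials in x\<close>

lemma form_add: "form d p \<Longrightarrow> form d q \<Longrightarrow> form d (p + q)"
  using keys_add[of p q] unfolding form_def by blast

lemma form_single:
  assumes "Poly_Mapping.keys m \<subseteq> {X 1, X 2, X 3}" "(\<Sum>v\<in>Poly_Mapping.keys m. expo m v) = d"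
  shows "form d (Poly_Mapping.single m c)"
  using assms by (simp add: form_def)

lemma form_lin [simp]: "form 1 (lin a)"
proof -
  have "form 1 (Const c * Var (X i))" if "i \<in> {1,2,3}" for c i
    using that by (auto simp: Const_def Var_def mult_single expo_def intro!: form_single)
  then show ?thesis
    unfolding lin_def by (intro form_add) auto
qed

lemma form_induct [consumes 1, case_names zero add mon]:
  assumes "form d p" "P 0" "\<And>p q. P p \<Longrightarrow> P q \<Longrightarrow> P (p + q)"
    "\<And>c i j k. i + j + k = d \<Longrightarrow> P (Const c * mon X i j k)"
  shows "P p"
proof -
  have sing: "P (Poly_Mapping.single m c)" if "m \<in> Poly_Mapping.keys p" for m c
  proof -
    have m: "Poly_Mapping.keys m \<subseteq> {X 1, X 2, X 3}" "(\<Sum>v\<in>Poly_Mapping.keys m. expo m v) = d"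
      using assms(1) that by (auto simp: form_def)
    have "m = monom3 X (expo m (X 1)) (expo m (X 2)) (expo m (X 3))"
    proof (rule poly_mapping_eqI)
      fix v
      show "Poly_Mapping.lookup m v = Poly_Mapping.lookup (monom3 X (expo m (X 1)) (expo m (X 2)) (expo m (X 3))) v"
        using m(1) by (cases "v \<in> {X 1, X 2, X 3}")
          (auto simp: monom3_def expo_def lookup_add lookup_single in_keys_iff subset_iff)
    qed
    moreover have "expo m (X 1) + expo m (X 2) + expo m (X 3) = d"
    proof -
      have "(\<Sum>v\<in>Poly_Mapping.keys m. expo m v) = (\<Sum>v\<in>{X 1, X 2, X 3}. expo m v)"
        by (rule sum.mono_neutral_left) (use m(1) in \<open>auto simp: expo_def in_keys_iff\<close>)
      then show ?thesis
        using m(2) by simp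
    qed
    ultimately show ?thesis
      using assms(4)[of "expo m (X 1)" "expo m (X 2)" "expo m (X 3)" c]
      by (simp add: mon_eq Const_def mult_single)
  qed
  have "P (\<Sum>m\<in>A. Poly_Mapping.single m (Poly_Mapping.lookup p m))" if "A \<subseteq> Poly_Mapping.keys p" for A
    using finite_subset[OF that finite_keys] that
    by (induction A rule: finite_induct) (auto simp: assms(2) intro!: assms(3) sing)
  moreover have "p = (\<Sum>m\<in>Poly_Mapping.keys p. Poly_Mapping.single m (Poly_Mapping.lookup p m))"
    by (rule poly_mapping_eqI) (auto simp: lookup_sum lookup_single when_def in_keys_iff)
  ultimately show ?thesis
    by (metis subset_refl)
qed

lemma form_1_iff: "form 1 p \<longleftrightarrow> (\<exists>a. p = lin a)"
proof
  show "\<exists>a. p = lin a" if "form 1 p"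
    using that
  proof (induction rule: form_induct)
    case zero
    show ?case by (rule exI[of _ "\<lambda>_. 0"]) (simp add: lin_def)
  next
    case (add p q)
    then obtain a b where "p = lin a" "q = lin b" by blast
    then have "p + q = lin (comb a b b 1 1 0)" by (simp add: lin_comb)
    then show ?case by blast
  next
    case (mon c i j k)
    then have "(i = 1 \<and> j = 0 \<and> k = 0) \<or> (i = 0 \<and> j = 1 \<and> k = 0) \<or> (i = 0 \<and> j = 0 \<and> k = 1)" by arith
    then have "mon X i j k = lin (ev 1) \<or> mon X i j k = lin (ev 2) \<or> mon X i j k = lin (ev 3)"
      unfolding lin_ev by (elim disjE) (simp_all add: mon_def)
    then obtain n where "mon X i j k = lin (ev n)"
      by blast
    then have "Const c * mon X i j k = lin (\<lambda>i. c * ev n i)" by (simp add: lin_scale)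
    then show ?case by blast
  qed
qed (use form_lin in blast)

section \<open>Every cubic form is a sum of cubes\<close>

definition cubes :: "(nat \<Rightarrow> complex) list \<Rightarrow> mpoly" where
  "cubes ls = (\<Sum>l\<leftarrow>ls. lin l ^ 3)"

lemma cubes_simps [simp]: "cubes [] = 0" "cubes (l # ls) = lin l ^ 3 + cubes ls" "cubes (ls @ ms) = cubes ls + cubes ms"
  by (simp_all add: cubes_def)

lemma complex_cube_root: "\<exists>w::complex. w ^ 3 = c"
proof -
  have "\<not> constant (poly [:- c, 0, 0, 1:])"
    by (simp add: constant_degree)
  from fundamental_theorem_of_algebra[OF this] obtain w where "poly [:- c, 0, 0, 1:] w = 0" by blast
  then have "w ^ 3 = c" by (simp add: power3_eq_cube algebra_simps)
  then show ?thesis by blast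
qed

text \<open>A scalar is absorbed into the linear form through a complex cube root.\<close>

lemma cube_scale: "\<exists>m. Const c * lin l ^ 3 = lin m ^ 3 \<and> (\<exists>w. w ^ 3 = c \<and> m = (\<lambda>i. w * l i))"
proof -
  obtain w where "w ^ 3 = c" using complex_cube_root by blast
  then have "Const c * lin l ^ 3 = lin (\<lambda>i. w * l i) ^ 3"
    by (auto simp: lin_scale power_mult_distrib Const_power)
  then show ?thesis using \<open>w ^ 3 = c\<close> by blast
qed

text \<open>Polarisation: in the signed sum of the four cubes every term except 24 l m n
  cancels.\<close>

lemma product_as_cubes:
  "Const c * (lin l * lin m * lin n) =
     Const (c/24) * lin (comb l m n 1 1 1) ^ 3 + Const (-c/24) * lin (comb l m n 1 1 (-1)) ^ 3
   + Const (-c/24) * lin (comb l m n 1 (-1) 1) ^ 3 + Const (c/24) * lin (comb l m n 1 (-1) (-1)) ^ 3"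
proof -
  have c: "Const c = Const (c/24) * 24" "Const (-c/24) = - Const (c/24)"
    by (simp_all flip: Const_simps Const_hom)
  show ?thesis
    unfolding c lin_comb by (simp add: Const_hom power3_eq_cube algebra_simps)
qed

lemma form_3_cubes: "form 3 f \<Longrightarrow> \<exists>ls. f = cubes ls"
proof (induction rule: form_induct)
  case zero
  show ?case by (rule exI[of _ "[]"]) simp
next
  case (add p q)
  then show ?case by (metis cubes_simps(3))
next
  case (mon c i j k)
  have "(i, j, k) \<in> {(i,j,k). i + j + k = 3}"
    using mon by simp
  then have "\<exists>l m n. l \<in> {1,2,3} \<and> m \<in> {1,2,3} \<and> n \<in> {1,2,3::nat} \<and> mon X i j k = Var (X l) * Var (X m) * Var (X n)"
    unfolding exponents_3 mon_def
    by (elim insertE emptyE; simp add: power2_eq_square power3_eq_cube; blast intro: mult.assoc mult.assoc[symmetric] mult_1_left[symmetric])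
  moreover have "\<exists>l. Var (X n) = lin l" if "n \<in> {1,2,3}" for n
    using that lin_ev by (metis insertE emptyE)
  ultimately have "\<exists>l m n. mon X i j k = lin l * lin m * lin n"
    by metis
  then obtain l m n where *: "mon X i j k = lin l * lin m * lin n" by blast
  obtain l1 l2 l3 l4 where
    "Const (c/24) * lin (comb l m n 1 1 1) ^ 3 = lin l1 ^ 3" "Const (-c/24) * lin (comb l m n 1 1 (-1)) ^ 3 = lin l2 ^ 3"
    "Const (-c/24) * lin (comb l m n 1 (-1) 1) ^ 3 = lin l3 ^ 3" "Const (c/24) * lin (comb l m n 1 (-1) (-1)) ^ 3 = lin l4 ^ 3"
    using cube_scale by metis
  then have "Const c * mon X i j k = cubes [l1, l2, l3, l4]"
    unfolding * product_as_cubes by simp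
  then show ?case by blast
qed

section \<open>Brackets and linear dependence\<close>

definition cross :: "(nat \<Rightarrow> complex) \<Rightarrow> (nat \<Rightarrow> complex) \<Rightarrow> nat \<Rightarrow> complex" where
  "cross u v i = (if i = 1 then u 2 * v 3 - u 3 * v 2 else if i = 2 then u 3 * v 1 - u 1 * v 3
      else u 1 * v 2 - u 2 * v 1)"

text \<open>The cofactors belonging to any coordinate \<open>j\<close> are the coefficients of a
  relation when the bracket vanishes. If they are zero for every \<open>j\<close>, then
  \<open>a\<close> and \<open>b\<close> are proportional, which gives a relation directly.\<close>

lemma br_eq_0_cases:
  assumes "br a b c = (0::complex)"
  obtains p q r where "(p, q, r) \<noteq> (0, 0, 0)" "\<And>i. i \<in> {1,2,3} \<Longrightarrow> comb a b c p q r i = 0"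
proof -
  have rel: "comb a b c (cross b c j) (cross c a j) (cross a b j) i = 0" if "i \<in> {1,2,3}" "j \<in> {1,2,3}" for i j
  proof -
    have "comb a b c (cross b c j) (cross c a j) (cross a b j) i = (if i = j then br a b c else 0)"
      using that by (elim insertE emptyE) (simp_all add: comb_def cross_def br_def algebra_simps)
    then show ?thesis using assms by simp
  qed
  show ?thesis
  proof (cases "\<exists>j\<in>{1,2,3}. (cross b c j, cross c a j, cross a b j) \<noteq> (0,0,0)")
    case True
    then obtain j where "j \<in> {1,2,3}" "(cross b c j, cross c a j, cross a b j) \<noteq> (0,0,0)" by blast
    then show ?thesis using that[of "cross b c j" "cross c a j" "cross a b j"] rel[of _ j] by blast
  next
    case False
    then have z: "cross a b 1 = 0" "cross a b 2 = 0" "cross a b 3 = 0" by auto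
    then have z: "a 2 * b 3 = a 3 * b 2" "a 3 * b 1 = a 1 * b 3" "a 1 * b 2 = a 2 * b 1"
      by (simp_all add: cross_def)
    show ?thesis
    proof (cases "\<exists>j\<in>{1,2,3}. a j \<noteq> 0")
      case True
      then obtain j where "j \<in> {1,2,3}" "a j \<noteq> 0" by blast
      then have "comb a b c (b j) (- a j) 0 i = 0" if "i \<in> {1,2,3}" for i
        using that z by (auto simp: comb_def algebra_simps)
      then show ?thesis using that[of "b j" "- a j" 0] \<open>a j \<noteq> 0\<close> by auto
    next
      case False
      then show ?thesis using that[of 1 0 0] by (auto simp: comb_def)
    qed
  qed
qed

text \<open>Replacing one row of the determinant by the combination multiplies it by the coefficient
  of that row.\<close>

lemma br_lin_comb_0:
  assumes "\<And>i. i \<in> {1,2,3} \<Longrightarrow> comb a b c p q r i = 0"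
  shows "p * br a b c = 0" "q * br a b c = 0" "r * br a b c = 0"
proof -
  let ?v = "comb a b c p q r"
  have "?v 1 = 0" "?v 2 = 0" "?v 3 = 0" using assms by simp_all
  then have "br ?v b c = 0" "br a ?v c = 0" "br a b ?v = 0"
    by (simp_all add: br_def)
  moreover have "br ?v b c = p * br a b c" "br a ?v c = q * br a b c" "br a b ?v = r * br a b c"
    by (simp_all add: br_def comb_def algebra_simps)
  ultimately show "p * br a b c = 0" "q * br a b c = 0" "r * br a b c = 0" by simp_all
qed

lemma lin_comb_eq_0_iff: "lin (comb a b c p q r) = 0 \<longleftrightarrow> (\<forall>i\<in>{1,2,3}. comb a b c p q r i = 0)"
  by (simp add: lin_eq_0_iff)

lemma lin_indep_3_iff: "lin_indep [lin a, lin b, lin c] \<longleftrightarrow> br a b c \<noteq> 0"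
proof -
  have *: "lin_indep [lin a, lin b, lin c] \<longleftrightarrow>
      (\<forall>k. lin (comb a b c (k 0) (k 1) (k 2)) = 0 \<longrightarrow> k 0 = 0 \<and> k 1 = 0 \<and> k (2::nat) = 0)"
    by (simp add: lin_indep_def lin_comb numeral_3_eq_3 numeral_2_eq_2 less_Suc_eq all_conj_distrib imp_conjR)
  show ?thesis
  proof
    assume indep: "lin_indep [lin a, lin b, lin c]"
    show "br a b c \<noteq> 0"
    proof
      assume "br a b c = 0"
      then obtain p q r where pqr: "(p, q, r) \<noteq> (0, 0, 0)" "\<And>i. i \<in> {1,2,3} \<Longrightarrow> comb a b c p q r i = 0"
        by (rule br_eq_0_cases) blast
      define k where "k n = (if n = 0 then p else if n = 1 then q else r)" for n :: nat
      have "lin (comb a b c (k 0) (k 1) (k 2)) = 0"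
        using pqr(2) by (simp add: k_def lin_comb_eq_0_iff)
      then have "p = 0 \<and> q = 0 \<and> r = 0"
        using indep unfolding * by (auto simp: k_def dest!: spec[of _ k])
      then show False using pqr(1) by simp
    qed
  next
    assume "br a b c \<noteq> 0"
    then show "lin_indep [lin a, lin b, lin c]"
      unfolding * lin_comb_eq_0_iff using br_lin_comb_0[of a b c] by (metis mult_eq_0_iff)
  qed
qed

lemma lin_indep_2: "br a b c \<noteq> 0 \<Longrightarrow> lin_indep [lin a, lin b]"
proof -
  assume D: "br a b c \<noteq> 0"
  have *: "lin_indep [lin a, lin b] \<longleftrightarrow>
      (\<forall>k. lin (comb a b c (k 0) (k (Suc 0)) 0) = 0 \<longrightarrow> k 0 = 0 \<and> k (Suc 0) = 0)"
    by (simp add: lin_indep_def lin_comb less_Suc_eq all_conj_distrib imp_conjR)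
  then show ?thesis
    unfolding * lin_comb_eq_0_iff using br_lin_comb_0[of a b c] D by (metis mult_eq_0_iff)
qed

text \<open>If the brackets with all three unit vectors vanish, so do all minors of \<open>a\<close>
  and \<open>b\<close>, and the two vectors are proportional.\<close>

lemma lin_indep_2_br:
  assumes "lin_indep [lin a, lin b]"
  shows "\<exists>c. br a b c \<noteq> 0"
proof (rule ccontr)
  assume no: "\<nexists>c. br a b c \<noteq> 0"
  have "br a b (ev 1) = 0" "br a b (ev 2) = 0" "br a b (ev 3) = 0" using no by blast+
  then have z: "a 2 * b 3 = a 3 * b 2" "a 3 * b 1 = a 1 * b 3" "a 1 * b 2 = a 2 * b 1"
    by (simp_all add: br_def ev_def algebra_simps)
  have *: "(\<forall>k. lin (comb a b b (k 0) (k (Suc 0)) 0) = 0 \<longrightarrow> k 0 = 0 \<and> k (Suc 0) = 0)"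
    using assms by (simp add: lin_indep_def lin_comb less_Suc_eq all_conj_distrib imp_conjR)
  have 2: "p = 0 \<and> q = 0" if "\<And>i. i \<in> {1,2,3} \<Longrightarrow> comb a b b p q 0 i = 0" for p q
    using *[rule_format, of "\<lambda>n. if n = 0 then p else q"] that by (simp add: lin_comb_eq_0_iff)
  show False
  proof (cases "\<exists>j\<in>{1,2,3}. a j \<noteq> 0")
    case True
    then obtain j where "j \<in> {1,2,3}" "a j \<noteq> 0" by blast
    then have "comb a b b (b j) (- a j) 0 i = 0" if "i \<in> {1,2,3}" for i
      using that z by (auto simp: comb_def algebra_simps)
    then show ?thesis using 2[of "b j" "- a j"] \<open>a j \<noteq> 0\<close> by auto
  next
    case False
    then show ?thesis using 2[of 1 0] by (auto simp: comb_def)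
  qed
qed

section \<open>Concomitants of special cubics\<close>

text \<open>The congruence of the symmetric matrix \<open>K\<close> by the matrix with rows
  \<open>a\<close>, \<open>b\<close>, \<open>c\<close>. By the chain rule, second derivatives in
  these linear coordinates are carried to those in x in this way.\<close>

definition cong3 :: "(nat \<Rightarrow> nat \<Rightarrow> 'a::comm_ring_1) \<Rightarrow> (nat \<Rightarrow> 'a) \<Rightarrow> (nat \<Rightarrow> 'a) \<Rightarrow> (nat \<Rightarrow> 'a) \<Rightarrow> nat \<Rightarrow> nat \<Rightarrow> 'a" where
  "cong3 K a b c i j = K 1 1 * a i * a j + K 2 2 * b i * b j + K 3 3 * c i * c j
    + K 1 2 * (a i * b j + a j * b i) + K 1 3 * (a i * c j + a j * c i) + K 2 3 * (b i * c j + b j * c i)"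

text \<open>For distinct indices among 1, 2, 3 the sum \<open>i + j\<close> identifies the
  off-diagonal position.\<close>

definition sym3 :: "'a \<Rightarrow> 'a \<Rightarrow> 'a \<Rightarrow> 'a \<Rightarrow> 'a \<Rightarrow> 'a \<Rightarrow> nat \<Rightarrow> nat \<Rightarrow> 'a" where
  "sym3 k11 k22 k33 k12 k13 k23 i j = (if i = j then (if i = 1 then k11 else if i = 2 then k22 else k33)
     else if i + j = 3 then k12 else if i + j = 4 then k13 else k23)"

lemma br_mult:
  fixes a b c :: "nat \<Rightarrow> 'a::comm_ring_1"
  assumes "\<And>i. i \<in> {1,2,3} \<Longrightarrow> u i = p1 * a i + q1 * b i + r1 * c i"
    "\<And>i. i \<in> {1,2,3} \<Longrightarrow> v i = p2 * a i + q2 * b i + r2 * c i"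
    "\<And>i. i \<in> {1,2,3} \<Longrightarrow> w i = p3 * a i + q3 * b i + r3 * c i"
  shows "br u v w = (p1 * (q2 * r3 - r2 * q3) - q1 * (p2 * r3 - r2 * p3) + r1 * (p2 * q3 - q2 * p3)) * br a b c"
  by (simp add: br_def assms) (simp add: algebra_simps)

lemma sdet_eq_br:
  assumes "H 2 1 = H 1 2" "H 3 1 = H 1 3" "H 3 2 = H 2 3"
  shows "sdet H = br (H 1) (H 2) (H 3)"
  using assms by (simp add: sdet_def br_def power2_eq_square algebra_simps)

lemma sdet_cong3: "sdet (cong3 K a b c) = (br a b c)\<^sup>2 * sdet K"
proof -
  define L where "L = sym3 (K 1 1) (K 2 2) (K 3 3) (K 1 2) (K 1 3) (K 2 3)"
  \<comment> \<open>\<open>M r\<close> is row \<open>r\<close> of \<open>K\<close> times the matrix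
    with rows \<open>a\<close>, \<open>b\<close>, \<open>c\<close>, so multiplicativity of
    determinants applies once on each side.\<close>
  define M where "M r i = L r 1 * a i + L r 2 * b i + L r 3 * c i" for r i :: nat
  have "sdet (cong3 K a b c) = br (cong3 K a b c 1) (cong3 K a b c 2) (cong3 K a b c 3)"
    by (rule sdet_eq_br) (simp_all add: cong3_def algebra_simps)
  also have "\<dots> = br a b c * br (M 1) (M 2) (M 3)"
  proof -
    have e: "cong3 K a b c i j = a i * M 1 j + b i * M 2 j + c i * M 3 j" for i j
      by (simp add: cong3_def M_def L_def sym3_def algebra_simps)
    show ?thesis
      by (subst br_mult[of _ "a 1" "M 1" "b 1" "M 2" "c 1" "M 3" _ "a 2" "b 2" "c 2" _ "a 3" "b 3" "c 3"])
         (simp_all only: e, simp add: br_def algebra_simps)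
  qed
  also have "br (M 1) (M 2) (M 3) = br (L 1) (L 2) (L 3) * br a b c"
    by (subst br_mult[of "M 1" "L 1 1" a "L 1 2" b "L 1 3" c "M 2" "L 2 1" "L 2 2" "L 2 3" "M 3" "L 3 1" "L 3 2" "L 3 3"])
       (simp_all only: M_def, simp add: br_def algebra_simps)
  also have "br (L 1) (L 2) (L 3) = sdet K"
    by (simp add: L_def sym3_def br_def sdet_def power2_eq_square algebra_simps)
  finally show ?thesis
    by (simp add: power2_eq_square algebra_simps)
qed

text \<open>The determinant is affine along a rank one update, which reduces congruence of \<open>qadj\<close> to that of \<open>sdet\<close>.\<close>

lemma qadj_eq_sdet_diff: "qadj H u = sdet (\<lambda>i j. H i j + u i * u j) - sdet H"
  by (simp add: qadj_def sdet_def power2_eq_square algebra_simps)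

text \<open>The rank one update by \<open>c\<close> only raises \<open>K 3 3\<close> by 1, and
  \<open>sdet K\<close> is affine in this entry with slope the upper left minor.\<close>

lemma qadj_cong3_line: "qadj (cong3 K a b c) c = (br a b c)\<^sup>2 * (K 1 1 * K 2 2 - (K 1 2)\<^sup>2)"
proof -
  have "(\<lambda>i j. cong3 K a b c i j + c i * c j) = cong3 (\<lambda>i j. if i = 3 \<and> j = 3 then K 3 3 + 1 else K i j) a b c"
    by (intro ext) (simp add: cong3_def algebra_simps)
  then have "qadj (cong3 K a b c) c =
      (br a b c)\<^sup>2 * (sdet (\<lambda>i j. if i = 3 \<and> j = 3 then K 3 3 + 1 else K i j) - sdet K)"
    by (simp only: qadj_eq_sdet_diff sdet_cong3 right_diff_distrib)
  also have "sdet (\<lambda>i j. if i = 3 \<and> j = 3 then K 3 3 + 1 else K i j) - sdet K = K 1 1 * K 2 2 - (K 1 2)\<^sup>2"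
    by (simp add: sdet_def algebra_simps)
  finally show ?thesis .
qed

text \<open>The third row and column of the matrix are 0, so the third vector may be replaced by
  \<open>u\<close>, which reduces to the previous lemma.\<close>

lemma qadj_cong3_rank2:
  "qadj (cong3 (sym3 k11 k22 0 k12 0 0) a b c) u = (br a b u)\<^sup>2 * (k11 * k22 - k12\<^sup>2)"
proof -
  have "cong3 (sym3 k11 k22 0 k12 0 0) a b c = cong3 (sym3 k11 k22 0 k12 0 0) a b u"
    by (intro ext) (simp add: cong3_def sym3_def)
  then show ?thesis
    by (simp add: qadj_cong3_line sym3_def)
qed

lemma sdet_cong_index: "(\<And>i j. i \<in> {1,2,3} \<Longrightarrow> j \<in> {1,2,3} \<Longrightarrow> H i j = H' i j) \<Longrightarrow> sdet H = sdet H'"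
  by (simp add: sdet_def)

lemma qadj_cong_index: "(\<And>i j. i \<in> {1,2,3} \<Longrightarrow> j \<in> {1,2,3} \<Longrightarrow> H i j = H' i j) \<Longrightarrow> qadj H u = qadj H' u"
  by (simp add: qadj_def)

section \<open>Hessians of normal forms, computed in adapted coordinates\<close>

lemma br_cc: "br (cc a) (cc b) (cc c) = Const (br a b c)"
  by (simp add: br_def Const_hom)

lemma Hess_cong3:
  assumes "xu f" "\<And>i j. i \<in> {1,2,3} \<Longrightarrow> j \<in> {1,2,3} \<Longrightarrow> Hm f i j = cong3 K (cc a) (cc b) (cc c) i j"
  shows "Hess f = Const ((br a b c)\<^sup>2 / 2) * sdet K"
proof -
  have "Hess f = Const (1/2) * sdet (cong3 K (cc a) (cc b) (cc c))"
    using sdet_cong_index[OF assms(2)] by (simp add: Hess_eq[OF assms(1)])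
  also have "\<dots> = Const (1/2) * Const ((br a b c)\<^sup>2) * sdet K"
    by (simp add: sdet_cong3 br_cc Const_power)
  also have "Const (1/2) * Const ((br a b c)\<^sup>2) = Const ((br a b c)\<^sup>2 / 2)"
    by (simp flip: Const_hom)
  finally show ?thesis .
qed

lemma Hess_cusp: "Hess (lin a ^ 2 * lin c + lin b ^ 3) = Const (-12 * (br a b c)\<^sup>2) * (lin a ^ 2 * lin b)"
proof -
  let ?K = "sym3 (2 * lin c) (6 * lin b) 0 0 (2 * lin a) 0"
  have "Hess (lin a ^ 2 * lin c + lin b ^ 3) = Const ((br a b c)\<^sup>2 / 2) * sdet ?K"
  proof (rule Hess_cong3)
    fix i j :: nat
    assume ij: "i \<in> {1,2,3}" "j \<in> {1,2,3}"
    show "Hm (lin a ^ 2 * lin c + lin b ^ 3) i j = cong3 ?K (cc a) (cc b) (cc c) i j"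
      by (simp add: Hm_def power2_eq_square power3_eq_cube pd_simps pd_lin[OF ij(1)] pd_lin[OF ij(2)])
        (simp add: cong3_def sym3_def algebra_simps)
  qed simp
  also have "sdet ?K = Const (-24) * (lin a ^ 2 * lin b)"
    by (simp add: sdet_def sym3_def Const_hom power2_eq_square algebra_simps)
  finally show ?thesis
    by (simp only: mult.assoc[symmetric] Const_hom(4)[symmetric]) simp
qed

text \<open>When \<open>k\<close> and the bracket are nonzero, the cubic is a conic with its tangent
  line \<open>a\<close>, and the Hessian is that line tripled, a form on which \<open>theta\<close>
  vanishes.\<close>

lemma Hess_conic_tangent:
  "Hess (lin a ^ 2 * lin c + Const k * (lin a * lin b ^ 2)) = Const (-4 * k * (br a b c)\<^sup>2) * lin a ^ 3"
proof -
  let ?K = "sym3 (2 * lin c) (2 * Const k * lin a) 0 (2 * Const k * lin b) (2 * lin a) 0"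
  have "Hess (lin a ^ 2 * lin c + Const k * (lin a * lin b ^ 2)) = Const ((br a b c)\<^sup>2 / 2) * sdet ?K"
  proof (rule Hess_cong3)
    fix i j :: nat
    assume ij: "i \<in> {1,2,3}" "j \<in> {1,2,3}"
    show "Hm (lin a ^ 2 * lin c + Const k * (lin a * lin b ^ 2)) i j = cong3 ?K (cc a) (cc b) (cc c) i j"
      by (simp add: Hm_def power2_eq_square power3_eq_cube pd_simps pd_lin[OF ij(1)] pd_lin[OF ij(2)])
        (simp add: cong3_def sym3_def algebra_simps)
  qed simp
  also have "sdet ?K = Const (-8 * k) * lin a ^ 3"
    by (simp add: sdet_def sym3_def Const_hom power2_eq_square power3_eq_cube algebra_simps)
  also have "Const ((br a b c)\<^sup>2 / 2) * (Const (-8 * k) * lin a ^ 3) = Const ((br a b c)\<^sup>2 / 2 * (-8 * k)) * lin a ^ 3"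
    by (simp only: Const_hom(4) mult.assoc)
  also have "(br a b c)\<^sup>2 / 2 * (-8 * k) = -4 * k * (br a b c)\<^sup>2"
    by simp
  finally show ?thesis .
qed

lemma Hess_fermat: "Hess (lin a ^ 3 + lin b ^ 3 + lin c ^ 3) = Const (108 * (br a b c)\<^sup>2) * (lin a * lin b * lin c)"
proof -
  let ?K = "sym3 (6 * lin a) (6 * lin b) (6 * lin c) 0 0 0"
  have "Hess (lin a ^ 3 + lin b ^ 3 + lin c ^ 3) = Const ((br a b c)\<^sup>2 / 2) * sdet ?K"
  proof (rule Hess_cong3)
    fix i j :: nat
    assume ij: "i \<in> {1,2,3}" "j \<in> {1,2,3}"
    show "Hm (lin a ^ 3 + lin b ^ 3 + lin c ^ 3) i j = cong3 ?K (cc a) (cc b) (cc c) i j"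
      by (simp add: Hm_def power2_eq_square power3_eq_cube pd_simps pd_lin[OF ij(1)] pd_lin[OF ij(2)])
        (simp add: cong3_def sym3_def algebra_simps)
  qed simp
  also have "sdet ?K = Const 216 * (lin a * lin b * lin c)"
    by (simp add: sdet_def sym3_def Const_hom power2_eq_square power3_eq_cube algebra_simps)
  finally show ?thesis
    by (simp only: mult.assoc[symmetric] Const_hom(4)[symmetric]) simp
qed

lemma Hess_4_cubes:
  fixes a b c p q r
  defines "w \<equiv> Const p * lin a + Const q * lin b + Const r * lin c"
  shows "Hess (lin a ^ 3 + lin b ^ 3 + lin c ^ 3 + lin (comb a b c p q r) ^ 3) =
    Const (108 * (br a b c)\<^sup>2) * (lin a * lin b * lin c
       + w * (Const (r\<^sup>2) * lin a * lin b + Const (q\<^sup>2) * lin a * lin c + Const (p\<^sup>2) * lin b * lin c))"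
proof -
  \<comment> \<open>The diagonal matrix of the first three cubes plus a rank one update from the
    fourth, with vector (p, q, r).\<close>
  let ?K = "sym3 (6 * lin a + 6 * Const p * Const p * w) (6 * lin b + 6 * Const q * Const q * w)
     (6 * lin c + 6 * Const r * Const r * w) (6 * Const p * Const q * w) (6 * Const p * Const r * w) (6 * Const q * Const r * w)"
  have "Hess (lin a ^ 3 + lin b ^ 3 + lin c ^ 3 + lin (comb a b c p q r) ^ 3) = Const ((br a b c)\<^sup>2 / 2) * sdet ?K"
  proof (rule Hess_cong3)
    fix i j :: nat
    assume ij: "i \<in> {1,2,3}" "j \<in> {1,2,3}"
    have "lin (comb a b c p q r) = w"
      by (simp add: lin_comb w_def)
    moreover have "pd (X n) w = Const p * Const (a n) + Const q * Const (b n) + Const r * Const (c n)" if "n \<in> {1,2,3}" for n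
      by (simp add: w_def pd_simps pd_lin[OF that])
    note this[OF ij(1)] this[OF ij(2)]
    ultimately show "Hm (lin a ^ 3 + lin b ^ 3 + lin c ^ 3 + lin (comb a b c p q r) ^ 3) i j = cong3 ?K (cc a) (cc b) (cc c) i j"
      by (simp add: Hm_def power2_eq_square power3_eq_cube pd_simps pd_lin[OF ij(1)] pd_lin[OF ij(2)])
        (simp add: cong3_def sym3_def algebra_simps)
  qed simp
  also have "sdet ?K = Const 216 * (lin a * lin b * lin c
       + w * (Const (r\<^sup>2) * lin a * lin b + Const (q\<^sup>2) * lin a * lin c + Const (p\<^sup>2) * lin b * lin c))"
    by (simp add: sdet_def sym3_def Const_hom power2_eq_square power3_eq_cube algebra_simps)
  finally show ?thesis
    by (simp only: mult.assoc[symmetric] Const_hom(4)[symmetric]) simp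
qed

section \<open>The concomitants \<open>theta\<close> and \<open>F6u\<close> of special
  cubics\<close>

lemma theta_cube: "theta (Const k * lin a ^ 3) = 0"
proof -
  have "theta (Const k * lin a ^ 3) = qadj (Hm (Const k * lin a ^ 3)) uu"
    by (rule theta_eq) simp
  \<comment> \<open>The matrix has a single nonzero entry, hence rank at most one; the second and
    third vectors are placeholders.\<close>
  also have "\<dots> = qadj (cong3 (sym3 (6 * Const k * lin a) 0 0 0 0 0) (cc a) (cc a) (cc a)) uu"
    by (rule qadj_cong_index)
      (simp add: Hm_def power2_eq_square power3_eq_cube pd_simps pd_lin cong3_def sym3_def algebra_simps del: insert_iff)
  finally show ?thesis
    by (simp add: qadj_cong3_rank2)
qed

text \<open>The second derivatives involve only the directions \<open>a\<close> and
  \<open>b\<close>, so \<open>qadj_cong3_rank2\<close> applies with a placeholder as third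
  vector.\<close>

lemma theta_double_line:
  "theta (Const k * (lin a ^ 2 * lin b)) = Const (- 4 * k\<^sup>2) * (br (cc a) (cc b) uu)\<^sup>2 * lin a ^ 2"
proof -
  have "theta (Const k * (lin a ^ 2 * lin b)) = qadj (Hm (Const k * (lin a ^ 2 * lin b))) uu"
    by (rule theta_eq) simp
  also have "\<dots> = qadj (cong3 (sym3 (2 * Const k * lin b) 0 0 (2 * Const k * lin a) 0 0) (cc a) (cc b) (cc a)) uu"
    by (rule qadj_cong_index)
      (simp add: Hm_def power2_eq_square power3_eq_cube pd_simps pd_lin cong3_def sym3_def algebra_simps del: insert_iff)
  finally show ?thesis
    by (simp add: qadj_cong3_rank2 Const_hom power2_eq_square algebra_simps)
qed

lemma theta_double_line_nonzero:
  assumes "br a b c \<noteq> 0" "k \<noteq> 0"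
  shows "theta (Const k * (lin a ^ 2 * lin b)) \<noteq> 0"
proof
  assume 0: "theta (Const k * (lin a ^ 2 * lin b)) = 0"
  have "\<exists>n\<in>{1,2,3}. a n \<noteq> 0"
    using assms(1) by (rule contrapos_np) (simp add: br_def)
  then obtain n where n: "n \<in> {1,2,3}" "a n \<noteq> 0"
    by blast
  \<comment> \<open>Evaluation at u = \<open>c\<close>, where the bracket is nonzero by assumption,
    and at a unit point x on which \<open>lin a\<close> does not vanish.\<close>
  define \<sigma> where "\<sigma> v = (case v of X i \<Rightarrow> Const (ev n i) | U i \<Rightarrow> Const (c i) | _ \<Rightarrow> 0)" for v
  have "subst \<sigma> (br (cc a) (cc b) uu) = Const (br a b c)"
    by (simp add: br_def subst_simps \<sigma>_def Const_hom)
  moreover have "subst \<sigma> (lin a) = Const (a n)"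
    using n(1) by (auto simp: lin_def subst_simps \<sigma>_def ev_def)
  ultimately have "subst \<sigma> (theta (Const k * (lin a ^ 2 * lin b))) = Const (-4 * k\<^sup>2 * (br a b c)\<^sup>2 * (a n)\<^sup>2)"
    by (simp add: theta_double_line subst_simps Const_hom Const_power)
  then show False
    using 0 assms n by (simp add: subst_diff)
qed

text \<open>As a form in x, \<open>theta\<close> is a multiple of the square of one linear form, so
  its matrix of second derivatives has rank at most one and its minors vanish.\<close>

lemma F6u_double_line: "F6u (Const k * (lin a ^ 2 * lin b)) = 0"
proof -
  define m where "m = Const (- 4 * k\<^sup>2) * (br (cc a) (cc b) uu)\<^sup>2"
  have m: "pd (X i) m = 0" for i
    by (simp add: m_def power2_eq_square br_def pd_simps)
  have "F6u (Const k * (lin a ^ 2 * lin b)) = Const (1/768) * qadj (Hm (m * lin a ^ 2)) uu"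
    using F6u_eq[of "Const k * (lin a ^ 2 * lin b)"] by (simp add: theta_double_line m_def)
  also have "qadj (Hm (m * lin a ^ 2)) uu = qadj (cong3 (sym3 (2 * m) 0 0 0 0 0) (cc a) (cc a) (cc a)) uu"
  proof (rule qadj_cong_index)
    fix i j :: nat
    assume ij: "i \<in> {1,2,3}" "j \<in> {1,2,3}"
    have "Hm (m * lin a ^ 2) i j = m * (2 * Const (a i) * Const (a j))"
      unfolding Hm_def by (simp add: m power2_eq_square pd_simps pd_lin[OF ij(1)] pd_lin[OF ij(2)] algebra_simps)
    then show "Hm (m * lin a ^ 2) i j = cong3 (sym3 (2 * m) 0 0 0 0 0) (cc a) (cc a) (cc a) i j"
      by (simp add: cong3_def sym3_def algebra_simps)
  qed
  finally show ?thesis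
    by (simp add: qadj_cong3_rank2)
qed

text \<open>Specialising \<open>u\<close> to constants commutes with derivatives in x, so it may be
  done before second derivatives of \<open>theta\<close> are taken.\<close>

lemma pd_X_subst_U: "pd (X i) (subst (case_coord (\<lambda>i. Var (X i)) (\<lambda>i. Var (Y i)) (\<lambda>i. Var (Z i)) (cc c)) p) =
    subst (case_coord (\<lambda>i. Var (X i)) (\<lambda>i. Var (Y i)) (\<lambda>i. Var (Z i)) (cc c)) (pd (X i) p)"
proof (induction p rule: mpoly_induct)
  case (Var v)
  show ?case by (cases v) (simp_all add: subst_diff)
qed (simp_all add: pd_simps subst_simps)

text \<open>
  On the line \<open>z = 0\<close> the form has three distinct zeros, and substituting the coordinates of this
  line for \<open>u\<close> turns \<open>F6u g\<close> into a nonzero multiple of the discriminant of the restriction.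
\<close>

lemma F6u_nonzero:
  fixes a b c p q k k1 k2 k3 k4 k5 k6
  defines "x \<equiv> lin a" and "y \<equiv> lin b" and "z \<equiv> lin c"
  assumes D: "br a b c \<noteq> 0" and nz: "p \<noteq> 0" "q \<noteq> 0" "k \<noteq> 0"
  defines "g \<equiv> Const k * (x * y * (Const p * x + Const q * y))
     + z * (Const k1 * x^2 + Const k2 * x * y + Const k3 * y^2 + Const k4 * x * z + Const k5 * y * z + Const k6 * z^2)"
  shows "F6u g \<noteq> 0"
proof
  assume F0: "F6u g = 0"
  define \<phi> where "\<phi> = subst (case_coord (\<lambda>i. Var (X i)) (\<lambda>i. Var (Y i)) (\<lambda>i. Var (Z i)) (cc c))"
  have hom: "\<phi> (p + q) = \<phi> p + \<phi> q" "\<phi> (p - q) = \<phi> p - \<phi> q" "\<phi> (p * q) = \<phi> p * \<phi> q" "\<phi> (p ^ n) = \<phi> p ^ n"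
    "\<phi> (Const t) = Const t" "\<phi> (Var (U i)) = Const (c i)" "\<phi> (Var (X i)) = Var (X i)" "\<phi> (numeral m) = numeral m"
    for p q n t i m
    by (simp_all add: \<phi>_def subst_simps)
  have xu_g: "xu g"
    by (simp add: g_def x_def y_def z_def)
  have \<phi>_Hm: "\<phi> (Hm p i j) = Hm (\<phi> p) i j" for i j p
    by (simp add: \<phi>_def pd_X_subst_U Hm_def)
  have \<phi>_qadj: "\<phi> (qadj H uu) = qadj (\<lambda>i j. \<phi> (H i j)) (cc c)" for H
    by (simp add: qadj_def hom)
  have \<phi>g: "\<phi> g = g"
    by (simp add: g_def x_def y_def z_def lin_def hom)
  \<comment> \<open>The second derivatives of \<open>g\<close> with respect to the coordinates
    \<open>x\<close>, \<open>y\<close>, \<open>z\<close>.\<close>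
  define K where "K = sym3 (Const (2*k*p) * y + Const (2*k1) * z) (Const (2*k*q) * x + Const (2*k3) * z)
     (Const (2*k4) * x + Const (2*k5) * y + Const (6*k6) * z)
     (Const (2*k*p) * x + Const (2*k*q) * y + Const k2 * z) (Const (2*k1) * x + Const k2 * y + Const (2*k4) * z)
     (Const k2 * x + Const (2*k3) * y + Const (2*k5) * z)"
  have Hg: "Hm g i j = cong3 K (cc a) (cc b) (cc c) i j" if "i \<in> {1,2,3}" "j \<in> {1,2,3}" for i j
    unfolding g_def Hm_def K_def x_def y_def z_def
    by (simp add: power2_eq_square pd_simps pd_lin[OF that(1)] pd_lin[OF that(2)])
      (simp add: cong3_def sym3_def Const_hom algebra_simps)
  define d where "d = br a b c"
  define Q where "Q = K 1 1 * K 2 2 - (K 1 2)\<^sup>2"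
  have \<theta>: "\<phi> (theta g) = Const (d\<^sup>2) * Q"
  proof -
    have "\<phi> (theta g) = qadj (Hm g) (cc c)"
      by (simp add: theta_eq[OF xu_g] \<phi>_qadj \<phi>_Hm \<phi>g)
    also have "\<dots> = qadj (cong3 K (cc a) (cc b) (cc c)) (cc c)"
      by (rule qadj_cong_index) (rule Hg)
    finally show ?thesis
      by (simp add: qadj_cong3_line br_cc Q_def d_def Const_power)
  qed
  \<comment> \<open>The second derivatives of \<open>d^2 Q\<close> in the same coordinates. On
    \<open>z = 0\<close>, \<open>Q\<close> equals
    \<open>-4 k^2 (p^2 x^2 + p q x y + q^2 y^2)\<close>, which determines the upper left
    block.\<close>
  define L where "L = sym3 (Const (- 8 * d\<^sup>2 * k\<^sup>2 * p\<^sup>2)) (Const (- 8 * d\<^sup>2 * k\<^sup>2 * q\<^sup>2)) (Const (d\<^sup>2 * (8 * k1 * k3 - 2 * k2\<^sup>2)))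
     (Const (- 4 * d\<^sup>2 * k\<^sup>2 * p * q)) (Const (d\<^sup>2 * (4 * k1 * k * q - 4 * k * p * k2))) (Const (d\<^sup>2 * (4 * k * p * k3 - 4 * k * q * k2)))"
  have HQ: "Hm (Const (d\<^sup>2) * Q) i j = cong3 L (cc a) (cc b) (cc c) i j" if "i \<in> {1,2,3}" "j \<in> {1,2,3}" for i j
    unfolding Q_def L_def Hm_def K_def x_def y_def z_def sym3_def
    by (simp add: power2_eq_square pd_simps pd_lin[OF that(1)] pd_lin[OF that(2)])
      (simp add: cong3_def Const_hom power2_eq_square algebra_simps)
  have "\<phi> (F6u g) = Const (1/768) * qadj (Hm (Const (d\<^sup>2) * Q)) (cc c)"
    by (simp add: F6u_eq[OF xu_g] hom \<phi>_qadj \<phi>_Hm \<theta>)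
  also have "qadj (Hm (Const (d\<^sup>2) * Q)) (cc c) = qadj (cong3 L (cc a) (cc b) (cc c)) (cc c)"
    by (rule qadj_cong_index) (rule HQ)
  \<comment> \<open>Only the upper left minor of \<open>L\<close> enters here; 48 = 64 - 16.\<close>
  also have "\<dots> = Const (d\<^sup>2 * (48 * (d\<^sup>2)\<^sup>2 * k^4 * p\<^sup>2 * q\<^sup>2))"
    by (simp add: qadj_cong3_line br_cc L_def sym3_def d_def flip: Const_power Const_hom)
      (simp add: power2_eq_square power4_eq_xxxx algebra_simps)
  finally have "\<phi> (F6u g) = Const (1/768 * (d\<^sup>2 * (48 * (d\<^sup>2)\<^sup>2 * k^4 * p\<^sup>2 * q\<^sup>2)))"
    by (simp only: Const_hom)
  moreover have "\<phi> 0 = 0"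
    by (simp add: \<phi>_def subst_diff)
  ultimately show False
    using F0 D nz by (simp add: d_def)
qed

section \<open>Values of S and T through brackets in adapted coordinates\<close>

definition det3 :: "complex \<times> complex \<times> complex \<Rightarrow> complex \<times> complex \<times> complex \<Rightarrow> complex \<times> complex \<times> complex \<Rightarrow> complex" where
  "det3 = (\<lambda>(p1,q1,r1) (p2,q2,r2) (p3,q3,r3).
     p1 * (q2 * r3 - r2 * q3) - q1 * (p2 * r3 - r2 * p3) + r1 * (p2 * q3 - q2 * p3))"

definition lc :: "(nat \<Rightarrow> complex) \<Rightarrow> (nat \<Rightarrow> complex) \<Rightarrow> (nat \<Rightarrow> complex) \<Rightarrow> complex \<times> complex \<times> complex \<Rightarrow> mpoly" where
  "lc a b c = (\<lambda>(p,q,r). lin (comb a b c p q r) ^ 3)"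

lemma S4_lc:
  "S4 (lc a b c s) (lc a b c t) (lc a b c u) (lc a b c v) =
     9 * (br a b c) ^ 4 * (det3 s t u * det3 v t u * det3 s v u * det3 s t v)"
  by (simp add: lc_def det3_def S4_cubes br_comb case_prod_unfold power4_eq_xxxx)

text \<open>A product of the four brackets with a repeated argument is 0, so only the 24 orderings
  of the four distinct cubes contribute. They contribute equally, and 216 = 9 * 24.\<close>

lemma S_inv_4_cubes:
  "S_inv (lin a ^ 3 + lin b ^ 3 + lin c ^ 3 + lin (comb a b c p q r) ^ 3) = 216 * (br a b c) ^ 4 * (p * q * r)"
proof -
  have "lin a ^ 3 + lin b ^ 3 + lin c ^ 3 + lin (comb a b c p q r) ^ 3 =
     lc a b c (1,0,0) + lc a b c (0,1,0) + lc a b c (0,0,1) + lc a b c (p,q,r)"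
    by (simp add: lc_def lin_comb)
  then show ?thesis
    by (simp only: S_inv_eq S4_additive S4_lc) (simp add: det3_def algebra_simps)
qed

lemma product_lc: "lin a * lin b * lin c = Const (1/24) * lc a b c (1,1,1) + Const (-1/24) * lc a b c (1,1,-1)
   + Const (-1/24) * lc a b c (1,-1,1) + Const (1/24) * lc a b c (1,-1,-1)"
  using product_as_cubes[of 1 a b c] by (simp add: lc_def)

text \<open>The Hessian is the product of the three forms, expanded into four signed cubes. Each
  sign matches the product of the coordinates of its cube, so the contributions add up instead of
  cancelling.\<close>

lemma T_inv_fermat: "\<exists>k. k \<noteq> 0 \<and> (\<forall>a b c. T_inv (lin a ^ 3 + lin b ^ 3 + lin c ^ 3) = k * (br a b c) ^ 6)"
proof -
  have *: "lin a ^ 3 + lin b ^ 3 + lin c ^ 3 = lc a b c (1,0,0) + lc a b c (0,1,0) + lc a b c (0,0,1)" for a b c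
    by (simp add: lc_def lin_comb)
  have "T_inv (lin a ^ 3 + lin b ^ 3 + lin c ^ 3) = 972 * (br a b c) ^ 6" for a b c
    by (simp only: T_inv_eq Hess_fermat product_lc)
      (simp only: * S4_additive S4_scale S4_lc, simp add: det3_def power2_eq_square eval_nat_numeral)
  then show ?thesis by (intro exI[of _ 972]) simp
qed

text \<open>This rests on 6 a^2 c = (a + c)^3 - (a - c)^3 - 2 c^3.\<close>

lemma cusp_lc: "lin a ^ 2 * lin c + lin b ^ 3 =
   Const (1/6) * lc a b c (1,0,1) + Const (-1/6) * lc a b c (1,0,-1) + Const (-1/3) * lc a b c (0,0,1) + lc a b c (0,1,0)" (is "_ = ?rhs")
proof -
  have c: "Const (-1/6) = - Const (1/6)" "Const (-1/3) = -2 * Const (1/6)"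
    by (simp_all flip: Const_simps Const_hom)
  have "Const (1/6) * 6 = 1"
    by (simp flip: Const_simps Const_hom)
  then have "lin a ^ 2 * lin c + lin b ^ 3 = Const (1/6) * (6 * (lin a ^ 2 * lin c)) + lin b ^ 3"
    by (simp flip: mult.assoc)
  also have "\<dots> = ?rhs"
    unfolding c lc_def by (simp add: lin_comb Const_hom power2_eq_square power3_eq_cube algebra_simps)
  finally show ?thesis .
qed

text \<open>The same identity; the third vector has coefficient 0 and places the cubes in the frame
  of \<open>cusp_lc\<close>.\<close>

lemma double_line_lc: "lin a ^ 2 * lin b =
   Const (1/6) * lc a b c (1,1,0) + Const (-1/6) * lc a b c (1,-1,0) + Const (-1/3) * lc a b c (0,1,0)" (is "_ = ?rhs")
proof -
  have c: "Const (-1/6) = - Const (1/6)" "Const (-1/3) = -2 * Const (1/6)"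
    by (simp_all flip: Const_simps Const_hom)
  have "Const (1/6) * 6 = 1"
    by (simp flip: Const_simps Const_hom)
  then have "lin a ^ 2 * lin b = Const (1/6) * (6 * (lin a ^ 2 * lin b))"
    by (simp flip: mult.assoc)
  also have "\<dots> = ?rhs"
    unfolding c lc_def by (simp add: lin_comb Const_hom power2_eq_square power3_eq_cube algebra_simps)
  finally show ?thesis .
qed

text \<open>Three of the four cubes in \<open>cusp_lc\<close> come from the span of \<open>a\<close>
  and \<open>c\<close>, so every product of four brackets vanishes.\<close>

lemma S_inv_cusp: "S_inv (lin a ^ 2 * lin c + lin b ^ 3) = 0"
  by (simp only: cusp_lc S_inv_eq S4_additive S4_scale S4_lc) (simp add: det3_def)

lemma T_inv_cusp: "T_inv (lin a ^ 2 * lin c + lin b ^ 3) = 0"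
  by (simp only: T_inv_eq Hess_cusp double_line_lc[of a b c])
    (simp only: cusp_lc S4_additive S4_scale S4_lc, simp add: det3_def)

section \<open>Binary cubics\<close>

lemma complex_root_of_cubic:
  fixes a b c d :: complex
  assumes "a \<noteq> 0"
  shows "\<exists>z. a * z ^ 3 + b * z\<^sup>2 + c * z + d = 0"
proof -
  have "\<not> constant (poly [:d, c, b, a:])"
    using assms by (simp add: constant_degree)
  from fundamental_theorem_of_algebra[OF this] obtain z where "poly [:d, c, b, a:] z = 0" by blast
  then show ?thesis by (intro exI[of _ z]) (simp add: power3_eq_cube power2_eq_square algebra_simps)
qed

lemma complex_root_of_quadratic:
  fixes a b c :: complex
  assumes "a \<noteq> 0"
  shows "\<exists>z. a * z\<^sup>2 + b * z + c = 0"
proof -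
  have "\<not> constant (poly [:c, b, a:])"
    using assms by (simp add: constant_degree)
  from fundamental_theorem_of_algebra[OF this] obtain z where "poly [:c, b, a:] z = 0" by blast
  then show ?thesis by (intro exI[of _ z]) (simp add: power2_eq_square algebra_simps)
qed

text \<open>If \<open>u = 0\<close>, the second variable is a factor; otherwise a root splits off a
  linear factor.\<close>

lemma binary_quadratic_factors:
  fixes u v w :: complex
  obtains a1 b1 a2 b2 where "u = a1 * a2" "v = a1 * b2 + b1 * a2" "w = b1 * b2"
proof (cases "u = 0")
  case True
  then show ?thesis using that[of 0 v w 1] by simp
next
  case False
  then obtain z where "u * z\<^sup>2 + v * z + w = 0" using complex_root_of_quadratic by blast
  then have "w = - z * (v + u * z)" by (simp add: power2_eq_square algebra_simps eq_neg_iff_add_eq_0)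
  then show ?thesis using that[of 1 u "v + u * z" "- z"] by (simp add: algebra_simps)
qed

lemma binary_cubic_factors:
  fixes A B C D :: complex
  obtains a1 b1 a2 b2 a3 b3 where "A = a1 * a2 * a3" "B = a1 * a2 * b3 + a1 * b2 * a3 + b1 * a2 * a3"
    "C = a1 * b2 * b3 + b1 * a2 * b3 + b1 * b2 * a3" "D = b1 * b2 * b3"
proof (cases "A = 0")
  case True
  obtain a1 b1 a2 b2 where "B = a1 * a2" "C = a1 * b2 + b1 * a2" "D = b1 * b2"
    by (rule binary_quadratic_factors)
  then show ?thesis using that[of 0 a1 a2 b2 b1 1] True by simp
next
  case False
  then obtain z where z: "A * z ^ 3 + B * z\<^sup>2 + C * z + D = 0" using complex_root_of_cubic by blast
  \<comment> \<open>These are the coefficients of the quotient by the linear factor belonging to the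
    root \<open>z\<close>.\<close>
  obtain a1 b1 a2 b2 where *: "A = a1 * a2" "B + A * z = a1 * b2 + b1 * a2" "C + B * z + A * z\<^sup>2 = b1 * b2"
    by (rule binary_quadratic_factors)
  show ?thesis
  proof (rule that[of 1 a1 a2 b2 b1 "- z"])
    show "A = 1 * a1 * a2" using * by simp
    show "B = 1 * a1 * b2 + 1 * b1 * a2 + - z * a1 * a2" using *(1,2) by algebra
    show "C = 1 * b1 * b2 + - z * a1 * b2 + - z * b1 * a2" using * by algebra
    show "D = - z * b1 * b2" using z *(3) by algebra
  qed
qed

text \<open>The negative of the usual discriminant of a binary cubic.\<close>

definition disc :: "complex \<Rightarrow> complex \<Rightarrow> complex \<Rightarrow> complex \<Rightarrow> complex" where
  "disc A B C D = 27 * A\<^sup>2 * D\<^sup>2 - 18 * A * B * C * D + 4 * A * C ^ 3 + 4 * B ^ 3 * D - B\<^sup>2 * C\<^sup>2"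

definition bin :: "complex \<Rightarrow> complex \<Rightarrow> complex \<Rightarrow> complex \<Rightarrow> mpoly \<Rightarrow> mpoly \<Rightarrow> mpoly" where
  "bin A B C D x y = Const A * x ^ 3 + Const B * (x ^ 2 * y) + Const C * (x * y ^ 2) + Const D * y ^ 3"

lemma bin_double_factor:
  fixes m1 m2 n1 n2 A B C D :: complex
  assumes "A = m1\<^sup>2 * n1" "B = 2 * m1 * m2 * n1 + m1\<^sup>2 * n2" "C = m2\<^sup>2 * n1 + 2 * m1 * m2 * n2" "D = m2\<^sup>2 * n2"
  shows "disc A B C D = 0" "bin A B C D (lin a) (lin b) = lin (comb a b b m1 m2 0) ^ 2 * lin (comb a b b n1 n2 0)"
  unfolding assms by (simp_all add: disc_def bin_def lin_comb Const_hom power2_eq_square power3_eq_cube algebra_simps)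

text \<open>\<open>w\<close> is a primitive cube root of unity, and the three linear factors of this
  difference of cubes are multiples of \<open>x\<close>, \<open>y\<close> and
  \<open>x + y\<close>.\<close>

lemma two_cubes_identity:
  fixes x y :: mpoly
  assumes w: "w\<^sup>2 + w + 1 = (0::complex)"
  shows "(x - Const w * y) ^ 3 - (x - Const (w\<^sup>2) * y) ^ 3 = Const (3 * (w\<^sup>2 - w)) * (x * y * (x + y))"
proof -
  define v where "v = Const w"
  have v2: "v * v = - v - 1"
  proof -
    have "w * w = - w - 1"
      using w by (simp add: power2_eq_square algebra_simps eq_neg_iff_add_eq_0)
    then have "v * v = Const (- w - 1)"
      unfolding v_def by (simp only: Const_hom(4)[symmetric])
    then show ?thesis
      by (simp add: v_def Const_hom)
  qed
  have v2': "v * (v * t) = - v * t - t" for t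
    unfolding mult.assoc[symmetric] v2 by (simp add: algebra_simps)
  show ?thesis
    by (simp add: Const_hom power2_eq_square power3_eq_cube flip: v_def)
      (simp add: v2 v2' algebra_simps)
qed

lemma triple_product_two_cubes:
  assumes "s \<noteq> 0" "t \<noteq> 0"
  shows "\<exists>m n. lin a * lin b * (Const s * lin a + Const t * lin b) = lin m ^ 3 + lin n ^ 3"
proof -
  obtain w where w: "w\<^sup>2 + w + 1 = (0::complex)"
    using complex_root_of_quadratic[of 1 1 1] by auto
  have nz: "w\<^sup>2 - w \<noteq> 0"
  proof
    assume "w\<^sup>2 - w = 0"
    then have "w = 0 \<or> w = 1" by (simp add: power2_eq_square)
    then show False using w by auto
  qed
  define c where "c = 1 / (s * t * (3 * (w\<^sup>2 - w)))"
  let ?x = "Const s * lin a" and ?y = "Const t * lin b"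
  have c: "c * (s * t * (3 * (w\<^sup>2 - w))) = 1"
    using nz assms by (simp add: c_def)
  have "Const c * ((?x - Const w * ?y) ^ 3 - (?x - Const (w\<^sup>2) * ?y) ^ 3) =
      Const (c * (s * t * (3 * (w\<^sup>2 - w)))) * (lin a * lin b * (?x + ?y))"
    unfolding two_cubes_identity[OF w] by (simp only: Const_hom) (simp add: ac_simps)
  then have "lin a * lin b * (?x + ?y) = Const c * (?x - Const w * ?y) ^ 3 + Const (- c) * (?x - Const (w\<^sup>2) * ?y) ^ 3"
    unfolding c by (simp add: Const_hom algebra_simps)
  moreover have "?x - Const u * ?y = lin (comb a b b s (- u * t) 0)" for u
    by (simp add: lin_comb Const_hom)
  ultimately show ?thesis
    using cube_scale by metis
qed

text \<open>The cubic factors into three linear forms. Two proportional factors give a double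
  factor; otherwise the third is a combination of the first two with nonzero coefficients, and
  \<open>triple_product_two_cubes\<close> applies.\<close>

lemma binary_cubic_cases:
  "(\<exists>m n. bin A B C D (lin a) (lin b) = lin m ^ 3 + lin n ^ 3) \<or>
   disc A B C D = 0 \<and> (\<exists>m n. bin A B C D (lin a) (lin b) = lin m ^ 2 * lin n)"
proof -
  obtain a1 b1 a2 b2 a3 b3 where f: "A = a1 * a2 * a3" "B = a1 * a2 * b3 + a1 * b2 * a3 + b1 * a2 * a3"
    "C = a1 * b2 * b3 + b1 * a2 * b3 + b1 * b2 * a3" "D = b1 * b2 * b3"
    by (rule binary_cubic_factors)
  have double: ?thesis if "A = m1\<^sup>2 * n1" "B = 2 * m1 * m2 * n1 + m1\<^sup>2 * n2" "C = m2\<^sup>2 * n1 + 2 * m1 * m2 * n2" "D = m2\<^sup>2 * n2"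
    for m1 m2 n1 n2
    using bin_double_factor[OF that] by blast
  \<comment> \<open>The pairwise determinants of the factors: by Cramer's rule, \<open>d\<close>
    times the third factor is \<open>s\<close> times the first plus \<open>t\<close> times the
    second.\<close>
  define d where "d = a1 * b2 - b1 * a2"
  define s where "s = (a3 * b2 - b3 * a2)"
  define t where "t = (a1 * b3 - b1 * a3)"
  consider "a1 = 0" "b1 = 0" | "(a1, b1) \<noteq> (0, 0)" "d = 0" | "d \<noteq> 0" "s = 0" | "d \<noteq> 0" "t = 0" | "d \<noteq> 0" "s \<noteq> 0" "t \<noteq> 0"
    by auto
  then show ?thesis
  proof cases
    case 1
    then show ?thesis using double[of 0 0 0 0] f by simp
  next
    case 2
    then obtain k where "a2 = k * a1" "b2 = k * b1"
    proof (cases "a1 = 0")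
      case True
      then show ?thesis using 2 that[of "b2 / b1"] by (auto simp: d_def)
    next
      case False
      then show ?thesis using 2 that[of "a2 / a1"] by (auto simp: d_def field_simps)
    qed
    then show ?thesis
      using double[of a1 "k * a3" b1 "k * b3"] f by (simp add: power2_eq_square algebra_simps)
  next
    case 3
    then have "d * a3 = t * a2" "d * b3 = t * b2"
      unfolding d_def s_def t_def by algebra+
    then have "a3 = t / d * a2" "b3 = t / d * b2"
      using 3 by (simp_all add: field_simps)
    then show ?thesis
      using double[of a2 "t / d * a1" b2 "t / d * b1"] f by (simp add: power2_eq_square algebra_simps)
  next
    case 4
    then have "d * a3 = s * a1" "d * b3 = s * b1"
      unfolding d_def s_def t_def by algebra+
    then have "a3 = s / d * a1" "b3 = s / d * b1"
      using 4 by (simp_all add: field_simps)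
    then show ?thesis
      using double[of a1 "s / d * a2" b1 "s / d * b2"] f by (simp add: power2_eq_square algebra_simps)
  next
    case 5
    let ?l = "comb a b b a1 b1 0" and ?m = "comb a b b a2 b2 0"
    have "d * a3 = s * a1 + t * a2" "d * b3 = s * b1 + t * b2"
      unfolding d_def s_def t_def by algebra+
    then have "a3 = s / d * a1 + t / d * a2" "b3 = s / d * b1 + t / d * b2"
      using 5 by (simp_all add: field_simps)
    then obtain s' t' where 3: "a3 = s' * a1 + t' * a2" "b3 = s' * b1 + t' * b2" "s' \<noteq> 0" "t' \<noteq> 0"
      using 5 that[of "s / d" "t / d"] by simp
    have "bin A B C D (lin a) (lin b) = lin ?l * lin ?m * (Const a3 * lin a + Const b3 * lin b)"
      unfolding f by (simp add: bin_def lin_comb Const_hom power2_eq_square power3_eq_cube algebra_simps)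
    also have "Const a3 * lin a + Const b3 * lin b = Const s' * lin ?l + Const t' * lin ?m"
      unfolding 3(1,2) by (simp add: lin_comb Const_hom algebra_simps)
    finally show ?thesis
      using triple_product_two_cubes[OF 3(3,4), of ?l ?m] by simp
  qed
qed

text \<open>In its last coefficient \<open>disc\<close> is a nonzero polynomial unless the first two
  coefficients vanish. So \<open>H\<close> can be divided between the two binary cubics with both
  values of \<open>disc\<close> nonzero, and each becomes two cubes.\<close>

lemma four_cubes:
  assumes "(A, B) \<noteq> (0, 0)" "(E, F) \<noteq> (0, 0)"
  shows "\<exists>k l m n. bin A B C H (lin a) (lin c) + bin E F G 0 (lin b) (lin c) = lin k ^ 3 + lin l ^ 3 + lin m ^ 3 + lin n ^ 3"
proof -
  have fin: "finite {t. disc A B C t = 0}" if "(A, B) \<noteq> (0, 0)" for A B C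
  proof -
    have "disc A B C t = poly [:4 * A * C ^ 3 - B\<^sup>2 * C\<^sup>2, 4 * B ^ 3 - 18 * A * B * C, 27 * A\<^sup>2:] t" for t
      by (simp add: disc_def power2_eq_square algebra_simps)
    moreover have "[:4 * A * C ^ 3 - B\<^sup>2 * C\<^sup>2, 4 * B ^ 3 - 18 * A * B * C, 27 * A\<^sup>2:] \<noteq> 0"
      using that by auto
    ultimately show ?thesis
      using poly_roots_finite by (simp only:)
  qed
  have "finite ({t. disc A B C t = 0} \<union> (\<lambda>t. H - t) ` {t. disc E F G t = 0})"
    using fin assms by blast
  then obtain t where t: "t \<notin> {t. disc A B C t = 0} \<union> (\<lambda>t. H - t) ` {t. disc E F G t = 0}"
    by (meson ex_new_if_finite infinite_UNIV_char_0)
  then have "disc A B C t \<noteq> 0" "disc E F G (H - t) \<noteq> 0"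
    by (auto simp: image_iff dest: spec[of _ "H - t"])
  then obtain k l m n where "bin A B C t (lin a) (lin c) = lin k ^ 3 + lin l ^ 3" "bin E F G (H - t) (lin b) (lin c) = lin m ^ 3 + lin n ^ 3"
    using binary_cubic_cases by metis
  moreover have "bin A B C H (lin a) (lin c) + bin E F G 0 (lin b) (lin c) =
      bin A B C t (lin a) (lin c) + bin E F G (H - t) (lin b) (lin c)"
    by (simp add: bin_def Const_hom algebra_simps)
  ultimately show ?thesis
    by (metis add.assoc)
qed

text \<open>The polar conic of \<open>(1, 1, 3 (p + q))\<close> is singular at \<open>(1, -1, 3 (q - p))\<close>; the new coordinates are dual to these points.\<close>

lemma node_four_cubes:
  "\<exists>k l m n. lin a * lin b * lin c + Const p * lin a ^ 3 + Const q * lin b ^ 3 = lin k ^ 3 + lin l ^ 3 + lin m ^ 3 + lin n ^ 3"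
proof -
  let ?X = "comb a b c (1/2) (1/2) 0" and ?Y = "comb a b c (1/2) (-1/2) 0"
  \<comment> \<open>The coefficients make the mixed terms \<open>X^2 Y\<close> and
    \<open>X Y^2\<close> cancel.\<close>
  let ?Z = "comb a b c (-3 * q) (-3 * p) 1"
  have a: "lin a = lin ?X + lin ?Y" and b: "lin b = lin ?X - lin ?Y"
    and c: "lin c = lin ?Z + Const (3 * (p + q)) * lin ?X + Const (3 * (q - p)) * lin ?Y"
  proof -
    have "Const (1/2) + Const (1/2) = 1"
      by (simp flip: Const_hom)
    then have h: "Const (1/2) * t + Const (1/2) * t = t" for t
      by (simp flip: distrib_right)
    have n: "Const (- (1/2)) = - Const (1/2)"
      by (rule Const_hom(3))
    have A: "lin a = lin ?X + lin ?Y" and B: "lin b = lin ?X - lin ?Y"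
      using h[of "lin a"] h[of "lin b"] by (simp_all add: lin_comb n)
    show "lin a = lin ?X + lin ?Y" "lin b = lin ?X - lin ?Y"
      by (rule A B)+
    have "lin ?Z + Const (3 * (p + q)) * lin ?X + Const (3 * (q - p)) * lin ?Y =
      lin ?Z + Const (3 * q) * (lin ?X + lin ?Y) + Const (3 * p) * (lin ?X - lin ?Y)"
      by (simp add: Const_hom algebra_simps)
    also have "\<dots> = lin c"
      unfolding A[symmetric] B[symmetric] by (simp add: lin_comb Const_hom)
    finally show "lin c = lin ?Z + Const (3 * (p + q)) * lin ?X + Const (3 * (q - p)) * lin ?Y" ..
  qed
  have "lin a * lin b * lin c + Const p * lin a ^ 3 + Const q * lin b ^ 3 =
      bin (4 * (p + q)) 1 0 0 (lin ?X) (lin ?Z) + bin (4 * (p - q)) (-1) 0 0 (lin ?Y) (lin ?Z)"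
    unfolding a b c by (simp add: bin_def Const_hom power2_eq_square power3_eq_cube algebra_simps)
  then show ?thesis
    using four_cubes[of "4 * (p + q)" 1 "4 * (p - q)" "-1" 0 0 ?X ?Z 0 ?Y] by simp
qed

section \<open>Classification of ternary cubics\<close>

definition dot :: "(nat \<Rightarrow> complex) \<Rightarrow> (nat \<Rightarrow> complex) \<Rightarrow> complex" where
  "dot l p = l 1 * p 1 + l 2 * p 2 + l 3 * p 3"

text \<open>The symmetric trilinear form of the cubic \<open>cubes ls\<close>, evaluated at points.\<close>

definition mom :: "(nat \<Rightarrow> complex) list \<Rightarrow> (nat \<Rightarrow> complex) \<Rightarrow> (nat \<Rightarrow> complex) \<Rightarrow> (nat \<Rightarrow> complex) \<Rightarrow> complex" where
  "mom ls p q r = (\<Sum>l\<leftarrow>ls. dot l p * dot l q * dot l r)"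

lemma mom_linear: "mom ls p q (comb a b c s t u) = s * mom ls p q a + t * mom ls p q b + u * mom ls p q c"
  by (induction ls) (simp_all add: mom_def dot_def comb_def algebra_simps)

lemma mom_cong: "(\<And>i. i \<in> {1,2,3} \<Longrightarrow> r i = s i) \<Longrightarrow> mom ls p q r = mom ls p q s"
  by (simp add: mom_def dot_def)

lemma cramer:
  assumes "br a b c \<noteq> 0" "i \<in> {1,2,3}"
  shows "l i = comb a b c (br l b c / br a b c) (br a l c / br a b c) (br a b l / br a b c) i"
proof -
  define d where "d = br a b c"
  have "d * l i = br l b c * a i + br a l c * b i + br a b l * c i"
    using assms(2) by (elim insertE emptyE) (simp_all add: d_def br_def algebra_simps)
  moreover have "d \<noteq> 0"
    using assms(1) by (simp add: d_def)
  ultimately have "l i = br l b c / d * a i + br a l c / d * b i + br a b l / d * c i"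
    by (simp add: field_simps)
  then show ?thesis
    by (simp only: comb_def d_def)
qed

lemma mom_commute: "mom ls p q r = mom ls q p r" "mom ls p q r = mom ls p r q"
  by (simp_all add: mom_def ac_simps)

lemma mom_quadratic:
  "mom ls (comb a b c x y 0) (comb a b c x y 0) v =
    x\<^sup>2 * mom ls a a v + 2 * x * y * mom ls a b v + y\<^sup>2 * mom ls b b v"
  by (induction ls) (simp_all add: mom_def dot_def comb_def power2_eq_square algebra_simps)

text \<open>The dual basis consists of the pairwise cross products divided by the
  determinant.\<close>

lemma dual_basis:
  assumes "br p w r \<noteq> 0"
  obtains a b c where "br a b c \<noteq> 0" "\<And>l. lin l = lin (comb a b c (dot l p) (dot l w) (dot l r))"
proof -
  define d where "d = br p w r"
  define a where "a i = cross w r i / d" for i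
  define b where "b i = cross r p i / d" for i
  define c where "c i = cross p w i / d" for i
  have d: "d \<noteq> 0" using assms by (simp add: d_def)
  have "br (cross w r) (cross r p) (cross p w) = d\<^sup>2"
    by (simp add: br_def cross_def d_def power2_eq_square algebra_simps)
  moreover have "br a b c = br (cross w r) (cross r p) (cross p w) / d ^ 3"
    using d by (simp add: br_def a_def b_def c_def field_simps power3_eq_cube)
  ultimately have "br a b c \<noteq> 0"
    using d by simp
  moreover have "lin l = lin (comb a b c (dot l p) (dot l w) (dot l r))" for l
  proof -
    have "d * l i = dot l p * cross w r i + dot l w * cross r p i + dot l r * cross p w i" if "i \<in> {1,2,3}" for i
      using that by (elim insertE emptyE) (simp_all add: d_def br_def cross_def dot_def algebra_simps)
    then have "l i = comb a b c (dot l p) (dot l w) (dot l r) i" if "i \<in> {1,2,3}" for i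
      using that d by (simp add: comb_def a_def b_def c_def field_simps)
    then show ?thesis
      by (intro lin_cong) simp_all
  qed
  ultimately show ?thesis
    using that by blast
qed

text \<open>In coordinates dual to \<open>p\<close>, \<open>w\<close>, \<open>r\<close>, the
  coefficients of a cubic are values of its trilinear form. The whole cube of \<open>c\<close> is
  put into the first binary cubic.\<close>

lemma cubes_dual_basis:
  assumes "\<And>l. lin l = lin (comb a b c (dot l p) (dot l w) (dot l r))"
  shows "cubes ls = bin (mom ls p p p) (3 * mom ls p p r) (3 * mom ls p r r) (mom ls r r r) (lin a) (lin c)
    + bin (mom ls w w w) (3 * mom ls w w r) (3 * mom ls w r r) 0 (lin b) (lin c)
    + Const (3 * mom ls p p w) * (lin a ^ 2 * lin b) + Const (3 * mom ls p w w) * (lin a * lin b ^ 2)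
    + Const (6 * mom ls p w r) * (lin a * lin b * lin c)"
proof (induction ls)
  case Nil
  show ?case by (simp add: mom_def bin_def)
next
  case (Cons l ls)
  have "lin l ^ 3 = (Const (dot l p) * lin a + Const (dot l w) * lin b + Const (dot l r) * lin c) ^ 3"
    by (subst assms) (simp add: lin_comb)
  moreover have "mom (l # ls) q s t = dot l q * dot l s * dot l t + mom ls q s t" for q s t
    by (simp add: mom_def)
  ultimately show ?case
    using Cons.IH by (simp add: bin_def Const_hom power2_eq_square power3_eq_cube algebra_simps)
qed

lemma extend_basis_2:
  assumes "\<not> (\<forall>i\<in>{1,2,3}. cross p w i = 0)"
  obtains r where "br p w r \<noteq> 0"
proof -
  have "br p w (ev i) = cross p w i" if "i \<in> {1,2,3}" for i
    using that by (elim insertE emptyE) (simp_all add: br_def cross_def ev_def)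
  then show ?thesis using assms that by metis
qed

lemma extend_basis_1:
  assumes "\<exists>i\<in>{1,2,3}. v i \<noteq> (0::complex)"
  obtains s t where "br s t v \<noteq> 0"
proof -
  have "br (ev 2) (ev 3) v = v 1" "br (ev 3) (ev 1) v = v 2" "br (ev 1) (ev 2) v = v 3"
    by (simp_all add: br_def ev_def)
  then show ?thesis using assms that by (metis insertE emptyE)
qed

text \<open>The determinant of the polar conic of \<open>p\<close> is a cubic in \<open>p\<close>,
  so it vanishes at some \<open>p\<close> on a suitable line; a kernel vector of the matrix then
  serves as \<open>w\<close>.\<close>

lemma polar_conic_singular:
  "\<exists>p w. (\<exists>i\<in>{1,2,3}. p i \<noteq> 0) \<and> (\<exists>i\<in>{1,2,3}. w i \<noteq> 0) \<and> (\<forall>r. mom ls p w r = 0)"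
proof -
  define M where "M p i j = mom ls p (ev i) (ev j)" for p and i j :: nat
  have Msym: "M p i j = M p j i" for p i j
    by (simp add: M_def mom_commute(2))
  have ev3: "mom ls p q r = r 1 * mom ls p q (ev 1) + r 2 * mom ls p q (ev 2) + r 3 * mom ls p q (ev 3)" for p q r
  proof -
    have "mom ls p q r = mom ls p q (comb (ev 1) (ev 2) (ev 3) (r 1) (r 2) (r 3))"
      by (simp add: mom_def dot_def comb_def ev_def)
    then show ?thesis by (simp only: mom_linear)
  qed
  have "\<exists>p. (\<exists>i\<in>{1,2,3}. p i \<noteq> 0) \<and> sdet (M p) = 0"
  proof (cases "sdet (M (ev 1)) = 0")
    case True
    then show ?thesis by (intro exI[of _ "ev 1"]) (simp add: ev_def)
  next
    case False
    define A where "A = M (ev 1)"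
    define B where "B = M (ev 2)"
    \<comment> \<open>The determinant along the line of points e2 + t e1, as a polynomial in
      t.\<close>
    define P where "P = sdet (\<lambda>i j. [:B i j, A i j:])"
    have P: "poly P t = sdet (\<lambda>i j. B i j + t * A i j)" for t
      by (simp add: P_def sdet_def power2_eq_square algebra_simps)
    \<comment> \<open>the third difference of a cubic is \<open>6\<close> times its leading coefficient\<close>
    have "poly P 3 - 3 * poly P 2 + 3 * poly P 1 - poly P 0 = 6 * sdet A"
      by (simp add: P sdet_def power2_eq_square algebra_simps)
    moreover have "poly P 3 - 3 * poly P 2 + 3 * poly P 1 - poly P 0 = 0" if "constant (poly P)"
    proof -
      have "poly P t = poly P 0" for t
        using that unfolding constant_def by blast
      from this[of 1] this[of 2] this[of 3] show ?thesis by simp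
    qed
    ultimately have "\<not> constant (poly P)"
      using False unfolding A_def by fastforce
    from fundamental_theorem_of_algebra[OF this] obtain t where "poly P t = 0" by blast
    moreover have "B i j + t * A i j = M (comb (ev 1) (ev 2) (ev 2) t 1 0) i j" for i j
      by (simp only: A_def B_def M_def mom_commute(1)[of ls _ "ev i"] mom_commute(2)[of ls "ev i" _ "ev j"] mom_linear) simp
    ultimately have "sdet (M (comb (ev 1) (ev 2) (ev 2) t 1 0)) = 0"
      by (simp add: P)
    moreover have "comb (ev 1) (ev 2) (ev 2) t 1 0 2 \<noteq> 0"
      by (simp add: comb_def ev_def)
    ultimately show ?thesis by blast
  qed
  then obtain p where p: "\<exists>i\<in>{1,2,3}. p i \<noteq> 0" "sdet (M p) = 0" by blast
  then have "br (M p 1) (M p 2) (M p 3) = 0"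
    using sdet_eq_br[of "M p"] Msym by metis
  then obtain x y z where xyz: "(x, y, z) \<noteq> (0, 0, 0)" "\<And>i. i \<in> {1,2,3} \<Longrightarrow> comb (M p 1) (M p 2) (M p 3) x y z i = 0"
    by (rule br_eq_0_cases) blast
  define w where "w = comb (ev 1) (ev 2) (ev 3) x y z"
  have w: "w 1 = x" "w 2 = y" "w 3 = z"
    by (simp_all add: w_def comb_def ev_def)
  have "mom ls p w (ev i) = 0" if "i \<in> {1,2,3}" for i
    using xyz(2)[OF that] by (simp add: w_def mom_commute(2)[of ls p _ "ev i"] mom_linear comb_def M_def)
  then have "mom ls p w r = 0" for r
    by (subst ev3) simp
  moreover have "\<exists>i\<in>{1,2,3}. w i \<noteq> 0"
    using xyz(1) w by auto
  ultimately show ?thesis using p(1) by blast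
qed

text \<open>Both shapes of a binary cubic are degenerate cases of \<open>Hess_fermat\<close> and
  \<open>Hess_cusp\<close> with a zero vector, where the bracket vanishes.\<close>

lemma Hess_binary: "Hess (bin A B C D (lin a) (lin b)) = 0"
proof -
  have z: "lin (\<lambda>_. 0) = 0" by (simp add: lin_def)
  have br0: "br m n (\<lambda>_. 0) = 0" "br m (\<lambda>_. 0) n = 0" for m n :: "nat \<Rightarrow> complex"
    by (simp_all add: br_def)
  have "Hess (lin m ^ 3 + lin n ^ 3) = 0" for m n
    using Hess_fermat[of m n "\<lambda>_. 0"] by (simp add: z)
  moreover have "Hess (lin m ^ 2 * lin n) = 0" for m n
    using Hess_cusp[of m n "\<lambda>_. 0"] by (simp add: z)
  ultimately show ?thesis
    using binary_cubic_cases[of A B C D a b] by auto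
qed

definition sum_of_4_cubes :: "mpoly \<Rightarrow> bool" where
  "sum_of_4_cubes f \<longleftrightarrow> (\<exists>k l m n. f = lin k ^ 3 + lin l ^ 3 + lin m ^ 3 + lin n ^ 3)"

definition cuspidal_shape :: "mpoly \<Rightarrow> bool" where
  "cuspidal_shape f \<longleftrightarrow> (\<exists>a b c A B C D. br a b c \<noteq> 0 \<and> f = lin a ^ 2 * lin c + bin A B C D (lin a) (lin b))"

text \<open>At the singular point \<open>v\<close>, the polar conic \<open>mom ls _ _ v\<close> is a
  binary quadratic form modulo \<open>v\<close>. Suitable directions \<open>s\<close> and
  \<open>t\<close> bring this tangent cone into normal form.\<close>

lemma singular_cubic:
  assumes v: "\<exists>i\<in>{1,2,3}. v i \<noteq> 0" and sing: "\<And>r. mom ls v v r = 0" and H: "Hess (cubes ls) \<noteq> 0"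
  shows "sum_of_4_cubes (cubes ls) \<or> cuspidal_shape (cubes ls)"
proof -
  obtain s0 t0 where st0: "br s0 t0 v \<noteq> 0"
    using v by (rule extend_basis_1)
  have "\<exists>s t. br s t v \<noteq> 0 \<and> mom ls s s v = 0"
  proof (cases "mom ls s0 s0 v = 0")
    case True
    then show ?thesis using st0 by blast
  next
    case False
    obtain z where "mom ls s0 s0 v * z\<^sup>2 + 2 * mom ls s0 t0 v * z + mom ls t0 t0 v = 0"
      using complex_root_of_quadratic[OF False] by blast
    then have "mom ls (comb s0 t0 v z 1 0) (comb s0 t0 v z 1 0) v = 0"
      by (simp add: mom_quadratic algebra_simps)
    moreover have "br (comb s0 t0 v z 1 0) s0 v = - br s0 t0 v"
      by (simp add: br_def comb_def algebra_simps)
    ultimately show ?thesis using st0 by (metis neg_equal_0_iff_equal)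
  qed
  then obtain s t1 where s: "br s t1 v \<noteq> 0" "mom ls s s v = 0" by blast
  have "\<exists>t. br s t v \<noteq> 0 \<and> (mom ls s t v = 0 \<or> mom ls t t v = 0)"
  proof (cases "mom ls s t1 v = 0")
    case True
    then show ?thesis using s by blast
  next
    case False
    \<comment> \<open>Since \<open>mom ls s s v = 0\<close>, the condition on
      \<open>t1 + u s\<close> is linear in \<open>u\<close>.\<close>
    define u where "u = - mom ls t1 t1 v / (2 * mom ls s t1 v)"
    have "mom ls (comb t1 s s 1 u 0) (comb t1 s s 1 u 0) v = mom ls t1 t1 v + 2 * u * mom ls s t1 v + u\<^sup>2 * mom ls s s v"
      by (simp add: mom_quadratic mom_commute(1)[of ls t1 s])
    also have "\<dots> = 0"
      using False s by (simp add: u_def)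
    finally have "mom ls (comb t1 s s 1 u 0) (comb t1 s s 1 u 0) v = 0" .
    moreover have "br s (comb t1 s s 1 u 0) v = br s t1 v"
      by (simp add: br_def comb_def algebra_simps)
    ultimately show ?thesis using s by metis
  qed
  then obtain t where t: "br s t v \<noteq> 0" "mom ls s t v = 0 \<or> mom ls t t v = 0" by blast
  obtain a b c where abc: "br a b c \<noteq> 0" "\<And>l. lin l = lin (comb a b c (dot l s) (dot l t) (dot l v))"
    using t(1) by (rule dual_basis) blast
  have v0: "mom ls s v v = 0" "mom ls t v v = 0" "mom ls v v v = 0"
    using sing mom_commute by metis+
  \<comment> \<open>At most one of the two terms with \<open>c\<close> is nonzero. The product
    \<open>a b c\<close> gives a node, \<open>b^2 c\<close> the cuspidal shape, and neither a binary
    cubic, which \<open>H\<close> excludes.\<close>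
  have f: "cubes ls = bin (mom ls s s s) (3 * mom ls s s t) (3 * mom ls s t t) (mom ls t t t) (lin a) (lin b)
      + Const (3 * mom ls t t v) * (lin b ^ 2 * lin c) + Const (6 * mom ls s t v) * (lin a * lin b * lin c)"
    unfolding cubes_dual_basis[OF abc(2), of ls] v0 s(2) by (simp add: bin_def algebra_simps)
  show ?thesis
  proof (cases "mom ls s t v = 0")
    case False
    then have ttv: "mom ls t t v = 0" using t(2) by blast
    define A where "A = mom ls s s s"
    define B where "B = mom ls s s t"
    define C where "C = mom ls s t t"
    define D where "D = mom ls t t t"
    define E where "E = mom ls s t v"
    \<comment> \<open>The middle terms of the binary cubic are divisible by \<open>a b\<close> and
      are absorbed into the third factor.\<close>
    have "cubes ls = lin a * lin b * lin (comb a b c (3 * B) (3 * C) (6 * E)) + Const A * lin a ^ 3 + Const D * lin b ^ 3"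
      unfolding f ttv A_def[symmetric] B_def[symmetric] C_def[symmetric] D_def[symmetric] E_def[symmetric]
      by (simp add: lin_comb bin_def Const_hom power2_eq_square algebra_simps)
    then show ?thesis
      using node_four_cubes by (simp add: sum_of_4_cubes_def)
  next
    case True
    show ?thesis
    proof (cases "mom ls t t v = 0")
      case True2: True
      have "Hess (cubes ls) = 0"
        unfolding f True True2 using Hess_binary by simp
      then show ?thesis using H by simp
    next
      case False
      define E where "E = mom ls t t v"
      have c': "lin (\<lambda>i. 3 * E * c i) = Const (3 * E) * lin c"
        by (rule lin_scale)
      have "cubes ls = lin b ^ 2 * lin (\<lambda>i. 3 * E * c i) + bin (mom ls t t t) (3 * mom ls s t t) (3 * mom ls s s t) (mom ls s s s) (lin b) (lin a)"
        unfolding f True E_def[symmetric] c' by (simp add: bin_def algebra_simps)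
      moreover have "br b a (\<lambda>i. 3 * E * c i) = - 3 * E * br a b c"
        by (simp add: br_def algebra_simps)
      then have "br b a (\<lambda>i. 3 * E * c i) \<noteq> 0"
        using abc(1) False by (simp add: E_def)
      ultimately show ?thesis
        unfolding cuspidal_shape_def by blast
    qed
  qed
qed

lemma cubic_cases:
  assumes "Hess (cubes ls) \<noteq> 0"
  shows "sum_of_4_cubes (cubes ls) \<or> cuspidal_shape (cubes ls)"
proof -
  obtain p w where p: "\<exists>i\<in>{1,2,3}. p i \<noteq> 0" and w: "\<exists>i\<in>{1,2,3}. w i \<noteq> 0" and pw: "\<And>r. mom ls p w r = 0"
    using polar_conic_singular by blast
  show ?thesis
  proof (cases "\<forall>i\<in>{1,2,3}. cross p w i = 0")
    case True
    \<comment> \<open>Here \<open>p\<close> is a nonzero multiple of \<open>w\<close>, so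
      \<open>w\<close> is a singular point of the cubic.\<close>
    then have "cross p w 1 = 0" "cross p w 2 = 0" "cross p w 3 = 0" by blast+
    then have z: "p 2 * w 3 = p 3 * w 2" "p 3 * w 1 = p 1 * w 3" "p 1 * w 2 = p 2 * w 1"
      by (simp_all add: cross_def)
    obtain j where j: "j \<in> {1,2,3}" "w j \<noteq> 0" using w by blast
    have "w j * p i = p j * w i" if "i \<in> {1,2,3}" for i
      using that j(1) z by (elim insertE emptyE) (simp_all add: mult.commute)
    then have pi: "p i = p j / w j * w i" if "i \<in> {1,2,3}" for i
      using that j(2) by (simp add: field_simps)
    define k where "k = p j / w j"
    have "k \<noteq> 0" using p pi by (auto simp: k_def)
    have "dot l p = k * dot l w" for l
      using pi[of 1] pi[of 2] pi[of 3] by (simp add: dot_def k_def algebra_simps)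
    then have "mom ls p w r = k * mom ls w w r" for r
      by (simp add: mom_def sum_list_const_mult mult.assoc)
    then have "mom ls w w r = 0" for r
      using pw \<open>k \<noteq> 0\<close> by simp
    then show ?thesis using singular_cubic[OF w _ assms] by blast
  next
    case False
    then obtain r where r: "br p w r \<noteq> 0" by (rule extend_basis_2)
    obtain a b c where abc: "\<And>l. lin l = lin (comb a b c (dot l p) (dot l w) (dot l r))"
      using r by (rule dual_basis) blast
    have span: "\<exists>x y z. \<forall>q s. mom ls q s u = x * mom ls q s p + y * mom ls q s w + z * mom ls q s r" for u
      using mom_cong[OF cramer[OF r, where l = u]] by (simp only: mom_linear) blast
    have 0: "mom ls p p w = 0" "mom ls p w w = 0"
      using pw mom_commute by metis+
    \<comment> \<open>All values of the trilinear form involving both \<open>p\<close> and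
      \<open>w\<close> are 0, so the cubic splits. If the leading two coefficients of one part
      vanish, \<open>p\<close> or \<open>w\<close> is a singular point; otherwise
      \<open>four_cubes\<close> applies.\<close>
    consider "mom ls p p p = 0" "mom ls p p r = 0" | "mom ls w w w = 0" "mom ls w w r = 0"
      | "(mom ls p p p, 3 * mom ls p p r) \<noteq> (0, 0)" "(mom ls w w w, 3 * mom ls w w r) \<noteq> (0, 0)"
      by auto
    then show ?thesis
    proof cases
      case 1
      then have "mom ls p p u = 0" for u
        using span[of u] 0 by auto
      then show ?thesis using singular_cubic[OF p _ assms] by blast
    next
      case 2
      then have "mom ls w w u = 0" for u
        using span[of u] pw mom_commute by (metis add.right_neutral mult_zero_right)
      then show ?thesis using singular_cubic[OF w _ assms] by blast
    next
      case 3
      have "cubes ls = bin (mom ls p p p) (3 * mom ls p p r) (3 * mom ls p r r) (mom ls r r r) (lin a) (lin c)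
          + bin (mom ls w w w) (3 * mom ls w w r) (3 * mom ls w r r) 0 (lin b) (lin c)"
        unfolding cubes_dual_basis[OF abc, of ls] 0 pw by simp
      then show ?thesis
        using four_cubes[OF 3] by (simp add: sum_of_4_cubes_def)
    qed
  qed
qed

section \<open>From four cubes to three cubes or a cusp\<close>

definition sum_of_3_cubes :: "mpoly \<Rightarrow> bool" where
  "sum_of_3_cubes f \<longleftrightarrow> (\<exists>k l m. f = lin k ^ 3 + lin l ^ 3 + lin m ^ 3)"

definition cusp :: "mpoly \<Rightarrow> bool" where
  "cusp f \<longleftrightarrow> (\<exists>a b c. br a b c \<noteq> 0 \<and> f = lin a ^ 2 * lin c + lin b ^ 3)"

text \<open>A relation with a nonzero coefficient expresses one form through the other two, which
  serve as \<open>a\<close> and \<open>b\<close>.\<close>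

lemma dependent_span:
  assumes "br l m n = 0"
  obtains a b p1 q1 p2 q2 p3 q3 where "lin l = Const p1 * lin a + Const q1 * lin b"
    "lin m = Const p2 * lin a + Const q2 * lin b" "lin n = Const p3 * lin a + Const q3 * lin b"
proof -
  obtain p q r where nz: "(p, q, r) \<noteq> (0, 0, 0)" and rel: "\<And>i. i \<in> {1,2,3} \<Longrightarrow> comb l m n p q r i = 0"
    using assms by (rule br_eq_0_cases) blast
  have lin0: "Const p * lin l + Const q * lin m + Const r * lin n = 0"
    using rel unfolding lin_comb[symmetric] by (simp add: lin_eq_0_iff)
  have solve: "lin u = Const (- y / x) * lin v + Const (- z / x) * lin w"
    if "Const x * lin u + Const y * lin v + Const z * lin w = 0" "x \<noteq> 0" for x y z u v w
  proof -
    have "Const (1 / x) * (Const x * lin u + Const y * lin v + Const z * lin w) =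
        lin u + Const (y / x) * lin v + Const (z / x) * lin w"
      using that(2) by (simp add: distrib_left flip: mult.assoc Const_hom)
    then have "lin u + Const (y / x) * lin v + Const (z / x) * lin w = 0"
      using that(1) by simp
    then have "lin u = - (Const (y / x) * lin v + Const (z / x) * lin w)"
      by (simp only: add.assoc eq_neg_iff_add_eq_0)
    then show ?thesis
      by (simp add: Const_hom)
  qed
  have triv: "lin u = Const 1 * lin u + Const 0 * lin v" "lin u = Const 0 * lin v + Const 1 * lin u" for u v
    by simp_all
  consider "p \<noteq> 0" | "q \<noteq> 0" | "r \<noteq> 0" using nz by blast
  then show ?thesis
  proof cases
    case 1
    show ?thesis
      by (rule that[OF solve[OF lin0 1] triv])
  next
    case 2
    have "Const q * lin m + Const p * lin l + Const r * lin n = 0"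
      using lin0 by (simp add: ac_simps)
    from that[OF triv(1) solve[OF this 2] triv(2)] show ?thesis .
  next
    case 3
    have "Const r * lin n + Const p * lin l + Const q * lin m = 0"
      using lin0 by (simp add: ac_simps)
    from that[OF triv solve[OF this 3]] show ?thesis .
  qed
qed

lemma binary_cubic_shape:
  "\<exists>m n. bin A B C D (lin a) (lin b) = lin m ^ 3 + lin n ^ 3 \<or> bin A B C D (lin a) (lin b) = lin m ^ 2 * lin n"
  using binary_cubic_cases[of A B C D a b] by blast

lemma three_dependent_cubes:
  assumes "br l m n = 0"
  obtains u v where "lin l ^ 3 + lin m ^ 3 + lin n ^ 3 = lin u ^ 3 + lin v ^ 3 \<or> lin l ^ 3 + lin m ^ 3 + lin n ^ 3 = lin u ^ 2 * lin v"
proof -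
  obtain a b p1 q1 p2 q2 p3 q3 where l: "lin l = Const p1 * lin a + Const q1 * lin b"
    "lin m = Const p2 * lin a + Const q2 * lin b" "lin n = Const p3 * lin a + Const q3 * lin b"
    using assms by (rule dependent_span)
  have "lin l ^ 3 + lin m ^ 3 + lin n ^ 3 = bin (p1 ^ 3 + p2 ^ 3 + p3 ^ 3) (3 * (p1\<^sup>2 * q1 + p2\<^sup>2 * q2 + p3\<^sup>2 * q3))
      (3 * (p1 * q1\<^sup>2 + p2 * q2\<^sup>2 + p3 * q3\<^sup>2)) (q1 ^ 3 + q2 ^ 3 + q3 ^ 3) (lin a) (lin b)"
    unfolding l by (simp add: bin_def Const_hom power2_eq_square power3_eq_cube algebra_simps)
  then show ?thesis
    using binary_cubic_shape that by metis
qed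

lemma double_line_three_cubes: "sum_of_3_cubes (lin m ^ 2 * lin n)"
proof -
  obtain u v w where "Const (1/6) * lin (comb m n n 1 1 0) ^ 3 = lin u ^ 3"
    "Const (-1/6) * lin (comb m n n 1 (-1) 0) ^ 3 = lin v ^ 3" "Const (-1/3) * lin (comb m n n 0 1 0) ^ 3 = lin w ^ 3"
    using cube_scale by metis
  then have "lin m ^ 2 * lin n = lin u ^ 3 + lin v ^ 3 + lin w ^ 3"
    using double_line_lc[of m n n] by (simp add: lc_def)
  then show ?thesis unfolding sum_of_3_cubes_def by blast
qed

lemma lin_zero: "lin (\<lambda>_. 0) = 0"
  by (simp add: lin_def)

lemma dependent_cusp_three_cubes:
  assumes "br a b c = 0"
  shows "sum_of_3_cubes (lin a ^ 2 * lin c + lin b ^ 3)"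
proof -
  obtain u v p1 q1 p2 q2 p3 q3 where l: "lin a = Const p1 * lin u + Const q1 * lin v"
    "lin b = Const p2 * lin u + Const q2 * lin v" "lin c = Const p3 * lin u + Const q3 * lin v"
    using assms by (rule dependent_span)
  have "lin a ^ 2 * lin c + lin b ^ 3 = bin (p1\<^sup>2 * p3 + p2 ^ 3) (2 * p1 * q1 * p3 + p1\<^sup>2 * q3 + 3 * p2\<^sup>2 * q2)
      (q1\<^sup>2 * p3 + 2 * p1 * q1 * q3 + 3 * p2 * q2\<^sup>2) (q1\<^sup>2 * q3 + q2 ^ 3) (lin u) (lin v)" (is "_ = ?b")
    unfolding l by (simp add: bin_def Const_hom power2_eq_square power3_eq_cube algebra_simps)
  moreover obtain m n where "?b = lin m ^ 3 + lin n ^ 3 \<or> ?b = lin m ^ 2 * lin n"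
    using binary_cubic_shape by blast
  moreover have "sum_of_3_cubes (lin m ^ 3 + lin n ^ 3)"
    unfolding sum_of_3_cubes_def by (intro exI[of _ m] exI[of _ n] exI[of _ "\<lambda>_. 0"]) (simp add: lin_zero)
  ultimately show ?thesis
    using double_line_three_cubes by metis
qed

text \<open>The three dependent cubes form a binary cubic, hence two cubes or u^2 v. In the latter
  case u^2 v + n^3 is a cusp if u, n, v are independent, and otherwise again a binary cubic.\<close>

lemma degenerate_four_cubes:
  assumes "br k l m = 0"
  shows "sum_of_3_cubes (lin k ^ 3 + lin l ^ 3 + lin m ^ 3 + lin n ^ 3) \<or>
     cusp (lin k ^ 3 + lin l ^ 3 + lin m ^ 3 + lin n ^ 3)"
proof -
  obtain u v where "lin k ^ 3 + lin l ^ 3 + lin m ^ 3 = lin u ^ 3 + lin v ^ 3 \<or> lin k ^ 3 + lin l ^ 3 + lin m ^ 3 = lin u ^ 2 * lin v"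
    using assms by (rule three_dependent_cubes)
  then show ?thesis
  proof
    assume "lin k ^ 3 + lin l ^ 3 + lin m ^ 3 = lin u ^ 3 + lin v ^ 3"
    then show ?thesis unfolding sum_of_3_cubes_def by auto
  next
    assume e: "lin k ^ 3 + lin l ^ 3 + lin m ^ 3 = lin u ^ 2 * lin v"
    show ?thesis
      unfolding e cusp_def using dependent_cusp_three_cubes by blast
  qed
qed

text \<open>Modulo the fourth form \<open>z\<close>, the Hessian is a multiple of
  \<open>x y c\<close>, and there \<open>c\<close> is a combination of \<open>x\<close> and
  \<open>y\<close> with nonzero coefficients, as \<open>F6u_nonzero\<close> requires.\<close>

lemma Hess_4_cubes_F6u:
  assumes D: "br a b c \<noteq> 0" and nz: "p \<noteq> 0" "q \<noteq> 0" "r \<noteq> 0"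
  shows "F6u (Hess (lin a ^ 3 + lin b ^ 3 + lin c ^ 3 + lin (comb a b c p q r) ^ 3)) \<noteq> 0"
proof -
  define w where "w = comb a b c p q r"
  define x where "x = lin a"
  define y where "y = lin b"
  define z where "z = lin w"
  \<comment> \<open>Coefficients from solving \<open>w = p a + q b + r c\<close> for
    \<open>c\<close>.\<close>
  define p' where "p' = - p / r"
  define q' where "q' = - q / r"
  define s where "s = 1 / r"
  define k where "k = 108 * (br a b c)\<^sup>2"
  have c: "lin c = Const p' * x + Const q' * y + Const s * z"
  proof -
    have "lin c = lin (comb a b w p' q' s)"
      by (rule lin_cong) (use nz in \<open>simp_all add: comb_def w_def p'_def q'_def s_def field_simps\<close>)
    then show ?thesis
      by (simp add: lin_comb x_def y_def z_def)
  qed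
  have w: "Const p * lin a + Const q * lin b + Const r * lin c = z"
    by (simp add: z_def w_def lin_comb)
  have "Hess (lin a ^ 3 + lin b ^ 3 + lin c ^ 3 + lin (comb a b c p q r) ^ 3) =
    Const k * (x * y * lin c + z * (Const (r\<^sup>2) * x * y + Const (q\<^sup>2) * x * lin c + Const (p\<^sup>2) * y * lin c))"
    by (simp only: Hess_4_cubes w) (simp add: x_def y_def k_def)
  also have "\<dots> = Const k * (x * y * (Const p' * x + Const q' * y))
      + z * (Const (k * q\<^sup>2 * p') * x^2 + Const (k * (s + r\<^sup>2 + q\<^sup>2 * q' + p\<^sup>2 * p')) * x * y + Const (k * p\<^sup>2 * q') * y^2
        + Const (k * q\<^sup>2 * s) * x * z + Const (k * p\<^sup>2 * s) * y * z + Const 0 * z^2)"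
    unfolding c by (simp add: Const_hom power2_eq_square algebra_simps)
  finally have *: "Hess (lin a ^ 3 + lin b ^ 3 + lin c ^ 3 + lin (comb a b c p q r) ^ 3) = \<dots>" .
  have "br a b w = r * br a b c"
    by (simp add: br_def w_def comb_def algebra_simps)
  then have "br a b w \<noteq> 0" "p' \<noteq> 0" "q' \<noteq> 0" "k \<noteq> 0"
    using D nz by (simp_all add: p'_def q'_def k_def)
  then show ?thesis
    unfolding * x_def y_def z_def by (rule F6u_nonzero)
qed

lemma four_cubes_cases:
  assumes "f = lin k ^ 3 + lin l ^ 3 + lin m ^ 3 + lin n ^ 3"
  shows "S_inv f \<noteq> 0 \<and> F6u (Hess f) \<noteq> 0 \<or> sum_of_3_cubes f \<or> cusp f"
proof -
  consider "br k l m = 0" | "br n l m = 0" | "br k n m = 0" | "br k l n = 0"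
    | "br k l m \<noteq> 0" "br n l m \<noteq> 0" "br k n m \<noteq> 0" "br k l n \<noteq> 0"
    by blast
  then show ?thesis
  proof cases
    case 1
    then show ?thesis using degenerate_four_cubes[of k l m n] assms by simp
  next
    case 2
    then show ?thesis using degenerate_four_cubes[of n l m k] assms by (simp add: ac_simps)
  next
    case 3
    then show ?thesis using degenerate_four_cubes[of k n m l] assms by (simp add: ac_simps)
  next
    case 4
    then show ?thesis using degenerate_four_cubes[of k l n m] assms by (simp add: ac_simps)
  next
    case 5
    define p where "p = br n l m / br k l m"
    define q where "q = br k n m / br k l m"
    define r where "r = br k l n / br k l m"
    have "lin n = lin (comb k l m p q r)"
      unfolding p_def q_def r_def by (rule lin_cong) (rule cramer[OF 5(1)]; simp)+
    then have f: "f = lin k ^ 3 + lin l ^ 3 + lin m ^ 3 + lin (comb k l m p q r) ^ 3"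
      using assms by simp
    have nz: "p \<noteq> 0" "q \<noteq> 0" "r \<noteq> 0"
      using 5 by (simp_all add: p_def q_def r_def)
    have "S_inv f \<noteq> 0"
      unfolding f S_inv_4_cubes using nz 5(1) by simp
    moreover have "F6u (Hess f) \<noteq> 0"
      unfolding f using 5(1) nz by (rule Hess_4_cubes_F6u)
    ultimately show ?thesis by blast
  qed
qed

text \<open>The line a + b + c = 0 meets the triangle \<open>a b c\<close> in three distinct points,
  so \<open>F6u_nonzero\<close> applies on it.\<close>

lemma F6u_Hess_fermat:
  assumes "br a b c \<noteq> 0"
  shows "F6u (Hess (lin a ^ 3 + lin b ^ 3 + lin c ^ 3)) \<noteq> 0"
proof -
  define w where "w = comb a b c 1 1 1"
  define k where "k = 108 * (br a b c)\<^sup>2"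
  have c: "lin c = lin w - lin a - lin b"
    by (simp add: w_def lin_comb)
  have "Const k * (lin a * lin b * lin c) = Const k * (lin a * lin b * (Const (-1) * lin a + Const (-1) * lin b))
    + lin w * (Const 0 * lin a ^ 2 + Const k * lin a * lin b + Const 0 * lin b ^ 2 + Const 0 * lin a * lin w + Const 0 * lin b * lin w + Const 0 * lin w ^ 2)"
    unfolding c by (simp add: Const_hom algebra_simps)
  moreover have "br a b w = br a b c"
    by (simp add: br_def w_def comb_def algebra_simps)
  ultimately show ?thesis
    using F6u_nonzero[of a b w "-1" "-1" k 0 k 0 0 0 0] assms unfolding Hess_fermat k_def[symmetric]
    by (simp add: k_def)
qed

text \<open>For \<open>D = 0\<close> the form \<open>a\<close> splits off and the Hessian is a
  multiple of its cube. For \<open>D\<close> nonzero, completing the cube in \<open>b\<close> leaves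
  only multiples of \<open>a^2\<close>, which are absorbed into \<open>c\<close>.\<close>

lemma cuspidal_shape_cases:
  assumes "cuspidal_shape f"
  shows "cusp f \<or> theta (Hess f) = 0"
proof -
  obtain a b c A B C D where D: "br a b c \<noteq> 0" and f: "f = lin a ^ 2 * lin c + bin A B C D (lin a) (lin b)"
    using assms unfolding cuspidal_shape_def by blast
  show ?thesis
  proof (cases "D = 0")
    case True
    have "f = lin a ^ 2 * lin (comb a b c A B 1) + Const C * (lin a * lin b ^ 2)"
      unfolding f True by (simp add: bin_def lin_comb power2_eq_square power3_eq_cube algebra_simps)
    then show ?thesis
      by (simp only: Hess_conic_tangent theta_cube simp_thms)
  next
    case False
    define e where "e = C / (3 * D)"
    have e: "C = 3 * D * e"
      using False by (simp add: e_def)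
    obtain w where w: "w ^ 3 = D"
      using complex_cube_root by blast
    let ?b = "comb a b c (w * e) w 0" and ?c = "comb a b c (A - D * e ^ 3) (B - 3 * D * e\<^sup>2) 1"
    have "f = lin a ^ 2 * lin ?c + lin ?b ^ 3"
      unfolding f e w[symmetric] by (simp add: bin_def lin_comb Const_hom power2_eq_square power3_eq_cube algebra_simps)
    moreover have "br a ?b ?c = w * br a b c"
      by (simp add: br_def comb_def algebra_simps)
    moreover have "w \<noteq> 0"
      using w False by auto
    ultimately show ?thesis
      using D unfolding cusp_def by (metis mult_eq_0_iff)
  qed
qed

lemma theta_0: "theta 0 = 0"
  using theta_cube[of 0 "\<lambda>_. 0"] by simp

text \<open>The case split behind (1) and (2): either condition excludes the first two
  alternatives.\<close>

lemma trichotomy: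
  assumes "form 3 f" "theta (Hess f) \<noteq> 0"
  shows "S_inv f \<noteq> 0 \<and> F6u (Hess f) \<noteq> 0 \<or> sum_of_3_cubes f \<or> cusp f"
proof -
  obtain ls where f: "f = cubes ls"
    using form_3_cubes[OF assms(1)] by blast
  have "Hess f \<noteq> 0"
    using assms(2) theta_0 by auto
  then consider "sum_of_4_cubes f" | "cuspidal_shape f"
    using cubic_cases f by blast
  then show ?thesis
  proof cases
    case 1
    then show ?thesis unfolding sum_of_4_cubes_def using four_cubes_cases by blast
  next
    case 2
    then show ?thesis using cuspidal_shape_cases assms(2) by blast
  qed
qed

text \<open>By \<open>Hess_fermat\<close>, a nonzero Hessian forces a nonzero bracket.\<close>

lemma sum_of_3_cubes_T_inv: "sum_of_3_cubes f \<Longrightarrow> Hess f \<noteq> 0 \<Longrightarrow> T_inv f \<noteq> 0"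
proof -
  assume "sum_of_3_cubes f" and H: "Hess f \<noteq> 0"
  then obtain a b c where f: "f = lin a ^ 3 + lin b ^ 3 + lin c ^ 3"
    unfolding sum_of_3_cubes_def by blast
  have "br a b c \<noteq> 0"
    using H unfolding f Hess_fermat by auto
  then show ?thesis
    using T_inv_fermat unfolding f by auto
qed

lemma sum_of_3_cubes_F6u: "sum_of_3_cubes f \<Longrightarrow> Hess f \<noteq> 0 \<Longrightarrow> F6u (Hess f) \<noteq> 0"
proof -
  assume "sum_of_3_cubes f" and H: "Hess f \<noteq> 0"
  then obtain a b c where f: "f = lin a ^ 3 + lin b ^ 3 + lin c ^ 3"
    unfolding sum_of_3_cubes_def by blast
  have "br a b c \<noteq> 0"
    using H unfolding f Hess_fermat by auto
  then show ?thesis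
    unfolding f by (rule F6u_Hess_fermat)
qed

lemma cusp_Hess:
  assumes "cusp f"
  obtains a b c where "br a b c \<noteq> 0" "Hess f = lin a ^ 2 * lin b" "S_inv f = 0" "T_inv f = 0"
proof -
  obtain a b c where D: "br a b c \<noteq> 0" and f: "f = lin a ^ 2 * lin c + lin b ^ 3"
    using assms unfolding cusp_def by blast
  define k where "k = -12 * (br a b c)\<^sup>2"
  have "Hess f = lin a ^ 2 * lin (\<lambda>i. k * b i)"
    unfolding f Hess_cusp lin_scale k_def by (simp add: ac_simps)
  moreover have "br a (\<lambda>i. k * b i) c = k * br a b c"
    by (simp add: br_def algebra_simps)
  then have "br a (\<lambda>i. k * b i) c \<noteq> 0"
    using D by (simp add: k_def)
  ultimately show ?thesis
    using that S_inv_cusp T_inv_cusp f by blast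
qed

lemma double_line_concomitants:
  assumes "br a b c \<noteq> 0"
  shows "theta (lin a ^ 2 * lin b) \<noteq> 0" "F6u (lin a ^ 2 * lin b) = 0"
  using theta_double_line_nonzero[OF assms, of 1] F6u_double_line[of 1 a b] by simp_all

section \<open>Waring rank\<close>

definition power_sum :: "nat \<Rightarrow> mpoly \<Rightarrow> bool" where
  "power_sum r f \<longleftrightarrow> (\<exists>l :: nat \<Rightarrow> mpoly. (\<forall>i<r. form 1 (l i)) \<and> f = (\<Sum>i<r. l i ^ 3))"

lemma waring_rank_eq: "waring_rank 3 f = (LEAST r. power_sum r f)"
  by (simp add: waring_rank_def power_sum_def)

lemma power_sum_iff: "power_sum r f \<longleftrightarrow> (\<exists>ls. length ls = r \<and> f = cubes ls)"
proof
  assume "power_sum r f"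
  then obtain l where l: "\<forall>i<r. form 1 (l i)" "f = (\<Sum>i<r. l i ^ 3)"
    unfolding power_sum_def by blast
  then obtain a where a: "\<And>i. i < r \<Longrightarrow> l i = lin (a i)"
    unfolding form_1_iff by metis
  have "f = cubes (map a [0..<r])"
    unfolding l(2) cubes_def by (simp add: a sum_list_sum_nth atLeast0LessThan)
  then show "\<exists>ls. length ls = r \<and> f = cubes ls"
    by (intro exI[of _ "map a [0..<r]"]) simp
next
  assume "\<exists>ls. length ls = r \<and> f = cubes ls"
  then obtain ls where ls: "length ls = r" "f = cubes ls" by blast
  have "f = (\<Sum>i<r. lin (ls ! i) ^ 3)"
    unfolding ls(2) cubes_def using ls(1) by (simp add: sum_list_sum_nth atLeast0LessThan)
  then show "power_sum r f"
    unfolding power_sum_def form_1_iff by (intro exI[of _ "\<lambda>i. lin (ls ! i)"]) blast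
qed

lemma power_sum_4: "power_sum 4 f \<longleftrightarrow> sum_of_4_cubes f"
proof -
  have "length ls = 4 \<longleftrightarrow> (\<exists>k l m n. ls = [k, l, m, n])" for ls :: "(nat \<Rightarrow> complex) list"
    by (auto simp: eval_nat_numeral length_Suc_conv)
  then have "(\<exists>ls. length ls = 4 \<and> f = cubes ls) \<longleftrightarrow> (\<exists>k l m n. f = cubes [k, l, m, n])"
    by metis
  then show ?thesis
    by (simp add: power_sum_iff sum_of_4_cubes_def add.assoc)
qed

lemma power_sum_3: "power_sum 3 f \<longleftrightarrow> sum_of_3_cubes f"
proof -
  have "length ls = 3 \<longleftrightarrow> (\<exists>k l m. ls = [k, l, m])" for ls :: "(nat \<Rightarrow> complex) list"
    by (auto simp: eval_nat_numeral length_Suc_conv)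
  then have "(\<exists>ls. length ls = 3 \<and> f = cubes ls) \<longleftrightarrow> (\<exists>k l m. f = cubes [k, l, m])"
    by metis
  then show ?thesis
    by (simp add: power_sum_iff sum_of_3_cubes_def add.assoc)
qed

text \<open>Shorter sums are padded with zero linear forms.\<close>

lemma power_sum_mono: "power_sum r f \<Longrightarrow> r \<le> s \<Longrightarrow> power_sum s f"
proof -
  assume "power_sum r f" "r \<le> s"
  then obtain ls where ls: "length ls = r" "f = cubes ls" by (auto simp: power_sum_iff)
  have "cubes (replicate n (\<lambda>_. 0)) = 0" for n
    by (induction n) (simp_all add: lin_zero)
  then have "length (ls @ replicate (s - r) (\<lambda>_. 0)) = s \<and> f = cubes (ls @ replicate (s - r) (\<lambda>_. 0))"
    using ls \<open>r \<le> s\<close> by simp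
  then show "power_sum s f" unfolding power_sum_iff by blast
qed

text \<open>\<open>form_3_cubes\<close> ensures that the minimum is attained, and monotonicity
  reduces all ranks below 4 to the failure at 3.\<close>

lemma waring_rank_4_iff:
  assumes "form 3 f"
  shows "waring_rank 3 f = 4 \<longleftrightarrow> sum_of_4_cubes f \<and> \<not> sum_of_3_cubes f"
proof
  assume r: "waring_rank 3 f = 4"
  have "\<exists>r. power_sum r f"
    using form_3_cubes[OF assms] by (auto simp: power_sum_iff)
  then have "power_sum 4 f"
    using LeastI_ex[of "\<lambda>r. power_sum r f"] r by (simp add: waring_rank_eq)
  moreover have "\<not> power_sum 3 f"
    using not_less_Least[of 3 "\<lambda>r. power_sum r f"] r by (simp add: waring_rank_eq)
  ultimately show "sum_of_4_cubes f \<and> \<not> sum_of_3_cubes f"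
    by (simp add: power_sum_4 power_sum_3)
next
  assume *: "sum_of_4_cubes f \<and> \<not> sum_of_3_cubes f"
  show "waring_rank 3 f = 4"
    unfolding waring_rank_eq
  proof (rule Least_equality)
    show "power_sum 4 f" using * by (simp add: power_sum_4)
    show "4 \<le> r" if "power_sum r f" for r
    proof (rule ccontr)
      assume "\<not> 4 \<le> r"
      then have "power_sum 3 f" using power_sum_mono[OF that, of 3] by simp
      then show False using * by (simp add: power_sum_3)
    qed
  qed
qed

lemma cusp_sum_of_4_cubes:
  assumes "cusp f"
  shows "sum_of_4_cubes f"
proof -
  obtain a b c where f: "f = lin a ^ 2 * lin c + lin b ^ 3"
    using assms unfolding cusp_def by blast
  show ?thesis
    using double_line_three_cubes[of a c] unfolding f sum_of_3_cubes_def sum_of_4_cubes_def by metis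
qed

theorem lemma5p12:
  fixes f :: mpoly
  assumes "form 3 f"
  shows
    "let C1 = (S_inv f = 0 \<and> T_inv f = 0 \<and> theta (Hess f) \<noteq> 0);
         C2 = (F6u (Hess f) = 0 \<and> theta (Hess f) \<noteq> 0);
         C3 = (\<exists>a b. form 1 a \<and> form 1 b \<and> lin_indep [a, b] \<and> Hess f = a ^ 2 * b);
         C4 = (\<exists>a b c. form 1 a \<and> form 1 b \<and> form 1 c \<and> lin_indep [a, b, c]
                 \<and> f = a ^ 2 * c + b ^ 3);
         C5 = (S_inv f = 0 \<and> waring_rank 3 f = 4)
     in (C1 \<longleftrightarrow> C2) \<and> (C2 \<longleftrightarrow> C3) \<and> (C3 \<longleftrightarrow> C4) \<and> (C4 \<longleftrightarrow> C5)"
proof -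
  have Hess0: "Hess f \<noteq> 0" if "theta (Hess f) \<noteq> 0"
    using that theta_0 by auto
  \<comment> \<open>Condition (4) is \<open>cusp f\<close>, the hub of the argument: (1), (2) and
    (5) imply it, (3) implies (2), and it implies (1), (3) and (5).\<close>
  have C4: "(\<exists>a b c. form 1 a \<and> form 1 b \<and> form 1 c \<and> lin_indep [a, b, c] \<and> f = a ^ 2 * c + b ^ 3) \<longleftrightarrow> cusp f"
    unfolding form_1_iff cusp_def using lin_indep_3_iff by metis
  have "cusp f" if "S_inv f = 0" "T_inv f = 0" "theta (Hess f) \<noteq> 0"
    using trichotomy[OF assms that(3)] sum_of_3_cubes_T_inv Hess0 that by blast
  moreover have "cusp f" if "F6u (Hess f) = 0" "theta (Hess f) \<noteq> 0"
    using trichotomy[OF assms that(2)] sum_of_3_cubes_F6u Hess0 that by blast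
  moreover have "F6u (Hess f) = 0 \<and> theta (Hess f) \<noteq> 0"
    if C3: "\<exists>a b. form 1 a \<and> form 1 b \<and> lin_indep [a, b] \<and> Hess f = a ^ 2 * b"
  proof -
    obtain a b where "lin_indep [lin a, lin b]" "Hess f = lin a ^ 2 * lin b"
      using C3 unfolding form_1_iff by blast
    then show ?thesis
      using lin_indep_2_br double_line_concomitants by metis
  qed
  moreover have "S_inv f = 0 \<and> T_inv f = 0 \<and> theta (Hess f) \<noteq> 0 \<and> waring_rank 3 f = 4
      \<and> (\<exists>a b. form 1 a \<and> form 1 b \<and> lin_indep [a, b] \<and> Hess f = a ^ 2 * b)" if "cusp f"
  proof -
    obtain a b c where abc: "br a b c \<noteq> 0" "Hess f = lin a ^ 2 * lin b" "S_inv f = 0" "T_inv f = 0"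
      using \<open>cusp f\<close> by (rule cusp_Hess)
    then have "theta (Hess f) \<noteq> 0"
      using double_line_concomitants(1) by simp
    \<comment> \<open>Three cubes are impossible, as \<open>T_inv f\<close> vanishes while the
      Hessian does not.\<close>
    moreover have "waring_rank 3 f = 4"
      using waring_rank_4_iff[OF assms] cusp_sum_of_4_cubes[OF \<open>cusp f\<close>] sum_of_3_cubes_T_inv Hess0[OF calculation] abc(4)
      by blast
    moreover have "lin_indep [lin a, lin b]"
      using abc(1) by (rule lin_indep_2)
    ultimately show ?thesis
      using abc form_lin by blast
  qed
  \<comment> \<open>Rank 4 supplies four cubes and rules out three; \<open>S_inv f = 0\<close> then
    leaves only the cusp in \<open>four_cubes_cases\<close>.\<close>
  moreover have "cusp f" if "S_inv f = 0" "waring_rank 3 f = 4"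
    using that waring_rank_4_iff[OF assms] four_cubes_cases unfolding sum_of_4_cubes_def by blast
  ultimately show ?thesis
    unfolding Let_def C4 by blast
qed

end
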